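(* Let $\Phi$ be an almost total Turing functional. If $Y\in\mathsf{W2R}_{\lambda_\Phi}$, then there is some $X\in\mathsf{W2R}$ with $X\in\mathrm{dom}(\Phi)$ and $\Phi(X)=Y$.
   Context: $2^{<\omega}$ is the set of finite binary strings, $\preceq$ the prefix order; $\lambda$ is the uniform measure on $2^\omega$. A Turing functional $\Phi$ is a c.e. set of pairs $(\sigma,\tau)$ of strings such that whenever $(\sigma,\tau),(\sigma',\tau')\in\Phi$ and $\sigma\preceq\sigma'$, $\tau,\tau'$ are comparable; $\Phi^X$ is the maximal finite or infinite sequence extending every $\tau$ with $(\sigma,\tau)\in\Phi$ for some $\sigma\preceq X$; $\mathrm{dom}(\Phi)=\{X:\Phi^X\text{ infinite}\}$ and $\Phi(X)=\Phi^X$ there. $\Phi$ is almost total if $\lambda(\mathrm{dom}(\Phi))=1$; then $\lambda_\Phi(\sigma)=\lambda(\{X:\Phi^X\succeq\sigma\})$ defines a computable probability measure. For a computable measure $\mu$, $X\in\mathsf{W2R}_\mu$ iff $X\notin\bigcap_i\mathcal U_i$ for every uniformly effectively open sequence $(\mathcal U_i)$ of subsets of $2^\omega$ with $\lim_i\mu(\mathcal U_i)=0$; $\mathsf{W2R}=\mathsf{W2R}_\lambda$. *)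

theory Defs
  imports "HOL-Probability.Probability" "HOL-Library.Sublist" "HOL-Library.Nat_Bijection"
begin

datatype recf = Z | S | Proj nat | Comp recf "recf list" | Prim recf recf | Mu recf

inductive eval :: "recf \<Rightarrow> nat list \<Rightarrow> nat \<Rightarrow> bool" where
  eval_Z: "eval Z xs 0"
| eval_S: "eval S (x # xs) (Suc x)"
| eval_Proj: "i < length xs \<Longrightarrow> eval (Proj i) xs (xs ! i)"
| eval_Comp: "list_all2 (\<lambda>g y. eval g xs y) gs ys \<Longrightarrow> eval f ys z \<Longrightarrow> eval (Comp f gs) xs z"
| eval_Prim0: "eval f xs z \<Longrightarrow> eval (Prim f g) (0 # xs) z"
| eval_PrimS: "eval (Prim f g) (y # xs) r \<Longrightarrow> eval g (r # y # xs) z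
     \<Longrightarrow> eval (Prim f g) (Suc y # xs) z"
| eval_Mu: "eval f (y # xs) 0 \<Longrightarrow> (\<forall>z<y. \<exists>v. 0 < v \<and> eval f (z # xs) v)
     \<Longrightarrow> eval (Mu f) xs y"

definition ce_set :: "nat set \<Rightarrow> bool" where
  "ce_set A \<longleftrightarrow> (\<exists>f. \<forall>n. n \<in> A \<longleftrightarrow> (\<exists>v. eval f [n] v))"

text \<open>Bijective coding of finite binary strings by naturals.\<close>
fun str_code :: "bool list \<Rightarrow> nat" where
  "str_code [] = 0"
| "str_code (b # bs) = 2 * str_code bs + (if b then 2 else 1)"

definition ce_strpairs :: "(bool list \<times> bool list) set \<Rightarrow> bool" where
  "ce_strpairs R \<longleftrightarrow> ce_set ((\<lambda>(a, b). prod_encode (str_code a, str_code b)) ` R)"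

definition ce_natstr :: "(nat \<times> bool list) set \<Rightarrow> bool" where
  "ce_natstr R \<longleftrightarrow> ce_set ((\<lambda>(i, b). prod_encode (i, str_code b)) ` R)"

definition prefix_of :: "bool list \<Rightarrow> (nat \<Rightarrow> bool) \<Rightarrow> bool" where
  "prefix_of \<sigma> X \<longleftrightarrow> (\<forall>i<length \<sigma>. X i = \<sigma> ! i)"

definition cyl :: "bool list \<Rightarrow> (nat \<Rightarrow> bool) set" where
  "cyl \<sigma> = {X. prefix_of \<sigma> X}"

definition cantor :: "(nat \<Rightarrow> bool) measure" where
  "cantor = PiM UNIV (\<lambda>_. measure_pmf (pmf_of_set (UNIV :: bool set)))"

definition turing_functional :: "(bool list \<times> bool list) set \<Rightarrow> bool" where
  "turing_functional \<Phi> \<longleftrightarrow> ce_strpairs \<Phi> \<and>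
     (\<forall>\<sigma> \<tau> \<sigma>' \<tau>'. (\<sigma>, \<tau>) \<in> \<Phi> \<longrightarrow> (\<sigma>', \<tau>') \<in> \<Phi> \<longrightarrow> prefix \<sigma> \<sigma>' \<longrightarrow>
        (prefix \<tau> \<tau>' \<or> prefix \<tau>' \<tau>))"

text \<open>outputs of Phi along X; Phi^X is the union (sup) of these\<close>
definition outs :: "(bool list \<times> bool list) set \<Rightarrow> (nat \<Rightarrow> bool) \<Rightarrow> bool list set" where
  "outs \<Phi> X = {\<tau>. \<exists>\<sigma>. (\<sigma>, \<tau>) \<in> \<Phi> \<and> prefix_of \<sigma> X}"

definition phi_ext :: "(bool list \<times> bool list) set \<Rightarrow> (nat \<Rightarrow> bool) \<Rightarrow> bool list \<Rightarrow> bool" where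
  "phi_ext \<Phi> X \<sigma> \<longleftrightarrow> (\<exists>\<tau>\<in>outs \<Phi> X. prefix \<sigma> \<tau>)"

definition phi_dom :: "(bool list \<times> bool list) set \<Rightarrow> (nat \<Rightarrow> bool) set" where
  "phi_dom \<Phi> = {X. \<forall>n. \<exists>\<tau>\<in>outs \<Phi> X. n \<le> length \<tau>}"

definition phi_apply :: "(bool list \<times> bool list) set \<Rightarrow> (nat \<Rightarrow> bool) \<Rightarrow> (nat \<Rightarrow> bool)" where
  "phi_apply \<Phi> X = (\<lambda>n. THE b. \<exists>\<tau>\<in>outs \<Phi> X. n < length \<tau> \<and> \<tau> ! n = b)"

definition almost_total :: "(bool list \<times> bool list) set \<Rightarrow> bool" where
  "almost_total \<Phi> \<longleftrightarrow> measure cantor (phi_dom \<Phi>) = 1"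

definition eff_open :: "(nat \<times> bool list) set \<Rightarrow> nat \<Rightarrow> (nat \<Rightarrow> bool) set" where
  "eff_open W i = (\<Union>\<sigma>\<in>{\<sigma>. (i, \<sigma>) \<in> W}. cyl \<sigma>)"

definition W2R :: "(nat \<Rightarrow> bool) measure \<Rightarrow> (nat \<Rightarrow> bool) set" where
  "W2R \<mu> = {X. \<not> (\<exists>W. ce_natstr W \<and> (\<lambda>i. measure \<mu> (eff_open W i)) \<longlonglongrightarrow> 0
                     \<and> X \<in> (\<Inter>i. eff_open W i))}"

end

theory Submission
  imports Defs
begin

text \<open>
  Write \<open>\<lambda>\<close> for the uniform measure and \<open>E \<tau>\<close> for the set of oracles whose image extends \<open>\<tau>\<close>.
  Given a test \<open>U\<close> with \<open>\<lambda> (U i) \<longlonglongrightarrow> 0\<close> and a number \<open>k\<close>, let \<open>V i\<close> be the union of the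
  cylinders of all \<open>\<tau>\<close> with \<open>\<mu> [\<tau>] < 2 ^ k * \<lambda> (U i \<inter> E \<tau>)\<close>. By the maximal inequality
  \<open>\<mu> (V i) \<le> 2 ^ k * \<lambda> (U i)\<close>, and \<open>V\<close> is uniformly effectively open because almost totality
  makes \<open>\<mu> [\<tau>]\<close> computable. Hence \<open>Y\<close> avoids some \<open>V i\<close>, so \<open>U i\<close> occupies at most the fraction
  \<open>2 ^ -k\<close> of \<open>E \<tau>\<close> for every prefix \<open>\<tau>\<close> of \<open>Y\<close>. Doing this for all of the countably many tests, the
  \<open>k\<close>-th one with the bound \<open>2 ^ -(k + 2)\<close>, one obtains an open set \<open>G\<close> that contains a component of
  every test and covers at most half of every \<open>E \<tau>\<close>. By compactness there is an \<open>X\<close> outside \<open>G\<close> all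
  of whose outputs are compatible with \<open>Y\<close>. It is weakly 2-random, hence lies in the domain (the
  complement of the domain is a union of effectively closed null sets), and is therefore mapped to \<open>Y\<close>.
\<close>

section \<open>Recursive functions and semidecidable predicates\<close>

text \<open>A function of finitely many variables is represented by a function of an infinite environment
  that assigns values to the variables 0, 1, 2, and so on; binding a variable shifts the environment.
  This makes composition and quantification free of arities.\<close>

type_synonym env = "nat \<Rightarrow> nat"

definition recursive :: "(env \<Rightarrow> nat) \<Rightarrow> bool" where
  "recursive F \<longleftrightarrow> (\<exists>f n. \<forall>m\<ge>n. \<forall>e. eval f (map e [0..<m]) (F e))"

definition decidable :: "(env \<Rightarrow> bool) \<Rightarrow> bool" where
  "decidable P \<longleftrightarrow> recursive (\<lambda>e. of_bool (P e))"

definition semidecidable :: "(env \<Rightarrow> bool) \<Rightarrow> bool" where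
  "semidecidable P \<longleftrightarrow>
     (\<exists>R. decidable R \<and> (\<forall>e. P e \<longleftrightarrow> (\<exists>s. R (case_nat s e))))"

named_theorems computability_intros

subsection \<open>Recursive functions\<close>

lemma recursive_proj [computability_intros]: "recursive (\<lambda>e. e i)"
proof -
  have "eval (Proj i) (map e [0..<m]) (e i)" if "m \<ge> Suc i" for m and e :: env
    using eval_Proj[of i "map e [0..<m]"] that by simp
  then show ?thesis unfolding recursive_def by blast
qed

lemma recursive_zero: "recursive (\<lambda>e. 0)"
  unfolding recursive_def using eval_Z by blast

lemma recursive_Suc [computability_intros]:
  assumes "recursive F"
  shows "recursive (\<lambda>e. Suc (F e))"
proof -
  obtain f n where f: "\<And>m e. m \<ge> n \<Longrightarrow> eval f (map e [0..<m]) (F e)"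
    using assms unfolding recursive_def by blast
  have "eval (Comp S [f]) (map e [0..<m]) (Suc (F e))" if "m \<ge> n" for m e
    by (rule eval_Comp[where ys = "[F e]"]) (use f that eval_S in auto)
  then show ?thesis unfolding recursive_def by blast
qed

lemma recursive_const [computability_intros]: "recursive (\<lambda>e. c)"
  by (induction c) (auto intro: recursive_zero recursive_Suc)

lemma recursive_subst:
  assumes "recursive F" and "\<And>i. recursive (\<lambda>e. E e i)"
  shows "recursive (\<lambda>e. F (E e))"
proof -
  obtain f n where f: "\<And>e. eval f (map e [0..<n]) (F e)"
    using assms(1) unfolding recursive_def by blast
  obtain g N where g: "\<And>i m e. m \<ge> N i \<Longrightarrow> eval (g i) (map e [0..<m]) (E e i)"
    using assms(2) unfolding recursive_def by metis
  have "eval (Comp f (map g [0..<n])) (map e [0..<m]) (F (E e))" if m: "m \<ge> (\<Sum>i<n. N i)" for m e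
  proof (rule eval_Comp)
    have "N i \<le> m" if "i < n" for i
      using member_le_sum[of i "{..<n}" N] that m by simp
    then show "list_all2 (\<lambda>h y. eval h (map e [0..<m]) y) (map g [0..<n]) (map (E e) [0..<n])"
      using g by (auto simp: list_all2_conv_all_nth)
  qed (use f in auto)
  then show ?thesis unfolding recursive_def by blast
qed

lemma recursive_case_nat [computability_intros]:
  "recursive F \<Longrightarrow> (\<And>j. recursive (\<lambda>e. E e j)) \<Longrightarrow> recursive (\<lambda>e. case_nat (F e) (E e) i)"
  by (cases i) auto

lemma recursive_apply:
  assumes "recursive (\<lambda>e. F (e 0) (\<lambda>i. e (Suc i)))" "recursive X" "\<And>i. recursive (\<lambda>e. E e i)"
  shows "recursive (\<lambda>e. F (X e) (E e))"
  using recursive_subst[OF assms(1), of "\<lambda>e. case_nat (X e) (E e)"]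
  by (simp add: recursive_case_nat assms(2,3))

lemma eval_Prim_if_trace:
  assumes "eval f xs (r 0)" and "\<And>y. y < n \<Longrightarrow> eval g (r y # y # xs) (r (Suc y))"
  shows "eval (Prim f g) (n # xs) (r n)"
  using assms(2)
proof (induction n)
  case 0
  show ?case by (rule eval_Prim0[OF assms(1)])
next
  case (Suc n)
  have "eval (Prim f g) (n # xs) (r n)" by (rule Suc.IH) (simp add: Suc.prems)
  then show ?case by (rule eval_PrimS) (simp add: Suc.prems)
qed

lemma recursive_rec_nat [computability_intros]:
  assumes "recursive A" and "recursive (\<lambda>e. B (e 0) (e (Suc 0)) (\<lambda>i. e (Suc (Suc i))))"
    and "recursive N"
  shows "recursive (\<lambda>e. rec_nat (A e) (\<lambda>y r. B r y e) (N e))"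
proof -
  obtain f k where f: "\<And>m e. m \<ge> k \<Longrightarrow> eval f (map e [0..<m]) (A e)"
    using assms(1) unfolding recursive_def by blast
  obtain g l where g: "\<And>m e. m \<ge> l \<Longrightarrow>
      eval g (map e [0..<m]) (B (e 0) (e (Suc 0)) (\<lambda>i. e (Suc (Suc i))))"
    using assms(2) unfolding recursive_def by blast
  define R where "R n e = rec_nat (A e) (\<lambda>y r. B r y e) n" for n e
  have R: "eval (Prim f g) (n # map e [0..<m]) (R n e)" if "m \<ge> max k l" for m n e
  proof (rule eval_Prim_if_trace[where r = "\<lambda>y. R y e"])
    show "eval g (R y e # y # map e [0..<m]) (R (Suc y) e)" for y
      using g[of "Suc (Suc m)" "case_nat (R y e) (case_nat y e)"] that
      by (simp add: R_def map_upt_Suc del: upt_Suc)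
  qed (use f that in \<open>simp add: R_def\<close>)
  have "eval (Prim f g) (map e [0..<m]) (R (e 0) (\<lambda>i. e (Suc i)))"
    if m: "m \<ge> Suc (max k l)" for m e
  proof -
    obtain m' where m': "m = Suc m'" "m' \<ge> max k l"
      using m by (cases m) auto
    show ?thesis unfolding m'(1) map_upt_Suc by (rule R[OF m'(2)])
  qed
  then have "recursive (\<lambda>e. R (e 0) (\<lambda>i. e (Suc i)))"
    unfolding recursive_def by (intro exI allI impI)
  then have "recursive (\<lambda>e. R (N e) e)"
    by (rule recursive_apply[where X = N]) (rule assms(3) recursive_proj)+
  then show ?thesis unfolding R_def .
qed

lemma recursive_add [computability_intros]:
  assumes "recursive F" "recursive G"
  shows "recursive (\<lambda>e. F e + G e)"
proof -
  have "recursive (\<lambda>e. rec_nat (F e) (\<lambda>y r. Suc r) (G e))"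
    by (intro computability_intros assms)
  moreover have "rec_nat a (\<lambda>y r. Suc r) b = a + b" for a b
    by (induction b) auto
  ultimately show ?thesis by simp
qed

lemma recursive_mult [computability_intros]:
  assumes "recursive F" "recursive G"
  shows "recursive (\<lambda>e. F e * G e)"
proof -
  have "recursive (\<lambda>e. rec_nat 0 (\<lambda>y r. r + F e) (G e))"
    by (intro computability_intros assms recursive_subst[OF assms(1)])
  moreover have "rec_nat 0 (\<lambda>y r. r + a) b = a * b" for a b :: nat
    by (induction b) auto
  ultimately show ?thesis by simp
qed

lemma recursive_power [computability_intros]:
  assumes "recursive F" "recursive G"
  shows "recursive (\<lambda>e. F e ^ G e)"
proof -
  have "recursive (\<lambda>e. rec_nat 1 (\<lambda>y r. r * F e) (G e))"
    by (intro computability_intros assms recursive_subst[OF assms(1)])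
  moreover have "rec_nat 1 (\<lambda>y r. r * a) b = a ^ b" for a b :: nat
    by (induction b) auto
  ultimately show ?thesis by simp
qed

lemma recursive_diff [computability_intros]:
  assumes "recursive F" "recursive G"
  shows "recursive (\<lambda>e. F e - G e)"
proof -
  have "recursive (\<lambda>e. rec_nat 0 (\<lambda>y r. y) (X e))" if "recursive X" for X
    by (intro computability_intros that)
  moreover have "rec_nat 0 (\<lambda>y r. y) n = n - 1" for n
    by (cases n) auto
  ultimately have "recursive (\<lambda>e. rec_nat (F e) (\<lambda>y r. r - 1) (G e))"
    by (simp add: recursive_rec_nat recursive_proj assms)
  moreover have "rec_nat a (\<lambda>y r. r - 1) b = a - b" for a b
    by (induction b) auto
  ultimately show ?thesis by simp
qed

lemma recursive_sum [computability_intros]: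
  assumes "recursive N" "recursive (\<lambda>e. F (e 0) (\<lambda>i. e (Suc i)))"
  shows "recursive (\<lambda>e. \<Sum>y<N e. F y e)"
proof -
  have "recursive (\<lambda>e. rec_nat 0 (\<lambda>y r. r + F y e) (N e))"
    by (intro computability_intros assms recursive_apply[OF assms(2)])
  moreover have "rec_nat 0 (\<lambda>y r. r + F y e) n = (\<Sum>y<n. F y e)" for n e
    by (induction n) auto
  ultimately show ?thesis by simp
qed

subsection \<open>Decidable predicates\<close>

lemma recursive_of_bool [computability_intros]: "decidable P \<Longrightarrow> recursive (\<lambda>e. of_bool (P e))"
  by (simp add: decidable_def)

lemma decidable_subst:
  assumes "decidable P" and "\<And>i. recursive (\<lambda>e. E e i)"
  shows "decidable (\<lambda>e. P (E e))"
  using recursive_subst[OF assms(1)[unfolded decidable_def] assms(2)] unfolding decidable_def .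

lemma decidable_const [computability_intros]: "decidable (\<lambda>e. b)"
  unfolding decidable_def by (rule recursive_const)

lemma decidable_not [computability_intros]:
  assumes "decidable P"
  shows "decidable (\<lambda>e. \<not> P e)"
proof -
  have "recursive (\<lambda>e. 1 - of_bool (P e))"
    by (intro computability_intros assms)
  moreover have "1 - of_bool b = (of_bool (\<not> b) :: nat)" for b by simp
  ultimately show ?thesis by (simp only: decidable_def)
qed

lemma decidable_conj [computability_intros]:
  "decidable P \<Longrightarrow> decidable Q \<Longrightarrow> decidable (\<lambda>e. P e \<and> Q e)"
  unfolding decidable_def of_bool_conj by (rule recursive_mult)

lemma decidable_disj [computability_intros]:
  assumes "decidable P" "decidable Q"
  shows "decidable (\<lambda>e. P e \<or> Q e)"
proof -
  have "decidable (\<lambda>e. \<not> (\<not> P e \<and> \<not> Q e))"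
    by (intro computability_intros assms)
  then show ?thesis by simp
qed

lemma decidable_le [computability_intros]:
  assumes "recursive F" "recursive G"
  shows "decidable (\<lambda>e. F e \<le> G e)"
proof -
  have "recursive (\<lambda>e. 1 - (F e - G e))"
    by (intro computability_intros assms)
  moreover have "1 - (a - b) = of_bool (a \<le> b)" for a b :: nat by auto
  ultimately show ?thesis by (simp add: decidable_def)
qed

lemma decidable_less [computability_intros]:
  assumes "recursive F" "recursive G"
  shows "decidable (\<lambda>e. F e < G e)"
proof -
  have "decidable (\<lambda>e. \<not> G e \<le> F e)"
    by (intro computability_intros assms)
  then show ?thesis by (simp add: not_le)
qed

lemma decidable_eq [computability_intros]:
  assumes "recursive F" "recursive G"
  shows "decidable (\<lambda>e. F e = G e)"
  unfolding order_eq_iff by (intro computability_intros assms)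

lemma decidable_ex_less [computability_intros]:
  assumes "recursive N" "decidable (\<lambda>e. P (e 0) (\<lambda>i. e (Suc i)))"
  shows "decidable (\<lambda>e. \<exists>y<N e. P y e)"
proof -
  have "decidable (\<lambda>e. 0 < (\<Sum>y<N e. of_bool (P y e) :: nat))"
    by (intro computability_intros assms)
  moreover have "0 < (\<Sum>y<n. of_bool (Q y) :: nat) \<longleftrightarrow> (\<exists>y<n. Q y)" for n and Q :: "nat \<Rightarrow> bool"
    by (auto simp: sum_nonneg_eq_0_iff simp flip: neq0_conv)
  ultimately show ?thesis by simp
qed

lemma decidable_all_less [computability_intros]:
  assumes "recursive N" "decidable (\<lambda>e. P (e 0) (\<lambda>i. e (Suc i)))"
  shows "decidable (\<lambda>e. \<forall>y<N e. P y e)"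
proof -
  have "decidable (\<lambda>e. \<not> (\<exists>y<N e. \<not> P y e))"
    by (intro computability_intros assms)
  then show ?thesis by simp
qed

lemma recursive_if_decidable_graph:
  assumes "recursive B" and "decidable (\<lambda>e. P (e 0) (\<lambda>i. e (Suc i)))"
    and bound: "\<And>e. F e \<le> B e" and graph: "\<And>y e. P y e \<longleftrightarrow> y = F e"
  shows "recursive F"
proof -
  have "recursive (\<lambda>e. \<Sum>y<Suc (B e). of_bool (P y e) * y)"
    by (intro computability_intros assms)
  moreover have "(\<Sum>y<Suc (B e). of_bool (P y e) * y) = F e" for e
  proof -
    have "(\<Sum>y<Suc (B e). of_bool (P y e) * y) = (\<Sum>y<Suc (B e). if F e = y then F e else 0)"
      by (rule sum.cong) (auto simp: graph)
    then show ?thesis using bound[of e] by (simp only: sum.delta') auto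
  qed
  ultimately show ?thesis by simp
qed

subsection \<open>Coding of pairs and finite sequences\<close>

lemma recursive_prod_encode [computability_intros]:
  assumes "recursive F" "recursive G"
  shows "recursive (\<lambda>e. prod_encode (F e, G e))"
proof -
  have "triangle n = (\<Sum>y<n. Suc y)" for n
    by (induction n) auto
  then have "prod_encode (a, b) = (\<Sum>y<a + b. Suc y) + a" for a b
    by (simp add: prod_encode_def)
  moreover have "recursive (\<lambda>e. (\<Sum>y<F e + G e. Suc y) + F e)"
    by (intro computability_intros assms)
  ultimately show ?thesis by simp
qed

lemma recursive_fst_prod_decode [computability_intros]:
  assumes "recursive F"
  shows "recursive (\<lambda>e. fst (prod_decode (F e)))"
proof (rule recursive_if_decidable_graph[where B = F])
  show "decidable (\<lambda>e. \<exists>b<Suc (F (\<lambda>i. e (Suc i))). prod_encode (e 0, b) = F (\<lambda>i. e (Suc i)))"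
    by (intro computability_intros recursive_subst[OF assms])
  show "fst (prod_decode (F e)) \<le> F e" for e
    using le_prod_encode_1[of "fst (prod_decode (F e))" "snd (prod_decode (F e))"] by simp
  show "(\<exists>b<Suc (F e). prod_encode (a, b) = F e) \<longleftrightarrow> a = fst (prod_decode (F e))" for a e
    by (metis fst_conv le_imp_less_Suc le_prod_encode_2 prod.collapse prod_decode_inverse
        prod_encode_inverse)
qed (fact assms)

lemma recursive_snd_prod_decode [computability_intros]:
  assumes "recursive F"
  shows "recursive (\<lambda>e. snd (prod_decode (F e)))"
proof (rule recursive_if_decidable_graph[where B = F])
  show "decidable (\<lambda>e. prod_encode (fst (prod_decode (F (\<lambda>i. e (Suc i)))), e 0) =
      F (\<lambda>i. e (Suc i)))"
    by (intro computability_intros recursive_subst[OF assms])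
  show "snd (prod_decode (F e)) \<le> F e" for e
    using le_prod_encode_2[of "snd (prod_decode (F e))" "fst (prod_decode (F e))"] by simp
  show "prod_encode (fst (prod_decode (F e)), b) = F e \<longleftrightarrow> b = snd (prod_decode (F e))" for b e
    by (metis prod.collapse prod_decode_inverse prod_encode_inverse snd_conv)
qed (fact assms)

definition entry :: "nat \<Rightarrow> nat \<Rightarrow> nat" where
  "entry c y = fst (prod_decode (rec_nat c (\<lambda>_ d. snd (prod_decode d)) y))"

lemma recursive_entry [computability_intros]:
  "recursive C \<Longrightarrow> recursive Y \<Longrightarrow> recursive (\<lambda>e. entry (C e) (Y e))"
  unfolding entry_def by (intro computability_intros)

lemma entry_prod_encode_0 [simp]: "entry (prod_encode (a, c)) 0 = a"
  by (simp add: entry_def)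

lemma entry_prod_encode_Suc [simp]: "entry (prod_encode (a, c)) (Suc y) = entry c y"
proof -
  let ?tl = "\<lambda>_ d. snd (prod_decode d)"
  have "rec_nat (prod_encode (a, c)) ?tl (Suc y) = rec_nat c ?tl y"
    by (induction y) auto
  then show ?thesis by (simp only: entry_def)
qed

lemma ex_entry_eq: "\<exists>c. \<forall>y<n. entry c y = r y"
proof (induction n arbitrary: r)
  case (Suc n)
  obtain c where "\<forall>y<n. entry c y = r (Suc y)"
    using Suc.IH[of "\<lambda>y. r (Suc y)"] by blast
  then show ?case
    by (intro exI[of _ "prod_encode (r 0, c)"]) (auto simp: less_Suc_eq_0_disj)
qed auto

lemma all_less_ex_iff_ex_entry: "(\<forall>x<n. \<exists>s. Q x s) \<longleftrightarrow> (\<exists>c. \<forall>x<n. Q x (entry c x))"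
proof
  assume "\<forall>x<n. \<exists>s. Q x s"
  then obtain r where "\<forall>x<n. Q x (r x)" by metis
  moreover obtain c where "\<forall>x<n. entry c x = r x" using ex_entry_eq by blast
  ultimately have "\<forall>x<n. Q x (entry c x)" by simp
  then show "\<exists>c. \<forall>x<n. Q x (entry c x)" ..
qed blast

lemma le_card_ex_iff_ex_entry:
  "k \<le> card {x. x < n \<and> (\<exists>s. Q x s)} \<longleftrightarrow> (\<exists>c. k \<le> card {x. x < n \<and> Q x (entry c x)})"
proof
  have "\<forall>x<n. \<exists>s. (\<exists>s. Q x s) \<longrightarrow> Q x s" by blast
  then obtain c where "\<forall>x<n. (\<exists>s. Q x s) \<longrightarrow> Q x (entry c x)"
    unfolding all_less_ex_iff_ex_entry by blast
  then have "{x. x < n \<and> Q x (entry c x)} = {x. x < n \<and> (\<exists>s. Q x s)}" by blast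
  then show "k \<le> card {x. x < n \<and> (\<exists>s. Q x s)} \<Longrightarrow> \<exists>c. k \<le> card {x. x < n \<and> Q x (entry c x)}"
    by metis
next
  assume "\<exists>c. k \<le> card {x. x < n \<and> Q x (entry c x)}"
  then obtain c where "k \<le> card {x. x < n \<and> Q x (entry c x)}" by blast
  also have "\<dots> \<le> card {x. x < n \<and> (\<exists>s. Q x s)}" by (rule card_mono) auto
  finally show "k \<le> card {x. x < n \<and> (\<exists>s. Q x s)}" .
qed

subsection \<open>Semidecidable predicates\<close>

lemma semidecidable_ex_decidable:
  assumes "decidable (\<lambda>e. R (e 0) (\<lambda>i. e (Suc i)))"
  shows "semidecidable (\<lambda>e. \<exists>s. R s e)"
  unfolding semidecidable_def
  by (intro exI[of _ "\<lambda>e. R (e 0) (\<lambda>i. e (Suc i))"]) (simp add: assms)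

lemma semidecidable_if_decidable:
  assumes "decidable P"
  shows "semidecidable P"
  using semidecidable_ex_decidable[of "\<lambda>_. P"] decidable_subst[OF assms recursive_proj] by simp

lemma semidecidable_subst:
  assumes "semidecidable P" and "\<And>i. recursive (\<lambda>e. E e i)"
  shows "semidecidable (\<lambda>e. P (E e))"
proof -
  obtain R where R: "decidable R" "\<And>e. P e \<longleftrightarrow> (\<exists>s. R (case_nat s e))"
    using assms(1) unfolding semidecidable_def by blast
  show ?thesis unfolding R(2)
    by (intro semidecidable_ex_decidable decidable_subst[OF R(1)] recursive_case_nat recursive_proj
        recursive_subst[OF assms(2)])
qed

lemma semidecidable_apply:
  assumes "semidecidable (\<lambda>e. P (e 0) (\<lambda>i. e (Suc i)))" "recursive X" "\<And>i. recursive (\<lambda>e. E e i)"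
  shows "semidecidable (\<lambda>e. P (X e) (E e))"
  using semidecidable_subst[OF assms(1), of "\<lambda>e. case_nat (X e) (E e)"]
  by (simp add: recursive_case_nat assms(2,3))

lemma semidecidable_under_binder:
  assumes "semidecidable (\<lambda>e. P (e 0) (\<lambda>i. e (Suc i)))"
  shows "\<exists>R. decidable R \<and> (\<forall>x e. P x e \<longleftrightarrow> (\<exists>s. R (case_nat s (case_nat x e))))"
proof -
  obtain R where R: "decidable R"
      "\<And>e. P (e 0) (\<lambda>i. e (Suc i)) \<longleftrightarrow> (\<exists>s. R (case_nat s e))"
    using assms unfolding semidecidable_def by blast
  have "P x e \<longleftrightarrow> (\<exists>s. R (case_nat s (case_nat x e)))" for x e
    using R(2)[of "case_nat x e"] by simp
  with R(1) show ?thesis by blast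
qed

lemma semidecidable_disj [computability_intros]:
  assumes "semidecidable P" "semidecidable Q"
  shows "semidecidable (\<lambda>e. P e \<or> Q e)"
proof -
  obtain R where R: "decidable R" "\<And>e. P e \<longleftrightarrow> (\<exists>s. R (case_nat s e))"
    using assms(1) unfolding semidecidable_def by blast
  obtain T where T: "decidable T" "\<And>e. Q e \<longleftrightarrow> (\<exists>s. T (case_nat s e))"
    using assms(2) unfolding semidecidable_def by blast
  have "semidecidable (\<lambda>e. \<exists>s. R (case_nat s e) \<or> T (case_nat s e))"
    by (intro semidecidable_ex_decidable decidable_disj decidable_subst[OF R(1)]
        decidable_subst[OF T(1)] recursive_case_nat recursive_proj)
  then show ?thesis by (simp add: R(2) T(2) ex_disj_distrib)
qed

lemma semidecidable_ex [computability_intros]: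
  assumes "semidecidable (\<lambda>e. P (e 0) (\<lambda>i. e (Suc i)))"
  shows "semidecidable (\<lambda>e. \<exists>x. P x e)"
proof -
  obtain R where R: "decidable R" and P: "\<And>x e. P x e \<longleftrightarrow> (\<exists>s. R (case_nat s (case_nat x e)))"
    using semidecidable_under_binder[OF assms] by blast
  have "semidecidable (\<lambda>e. \<exists>t.
      R (case_nat (fst (prod_decode t)) (case_nat (snd (prod_decode t)) e)))"
    by (intro semidecidable_ex_decidable decidable_subst[OF R] computability_intros)
  moreover have "(\<exists>t. R (case_nat (fst (prod_decode t)) (case_nat (snd (prod_decode t)) e))) \<longleftrightarrow>
      (\<exists>x. P x e)" for e
    unfolding P by (metis fst_conv prod_encode_inverse snd_conv)
  ultimately show ?thesis by simp
qed

lemma semidecidable_conj [computability_intros]: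
  assumes "semidecidable P" "semidecidable Q"
  shows "semidecidable (\<lambda>e. P e \<and> Q e)"
proof -
  obtain R where R: "decidable R" "\<And>e. P e \<longleftrightarrow> (\<exists>s. R (case_nat s e))"
    using assms(1) unfolding semidecidable_def by blast
  obtain T where T: "decidable T" "\<And>e. Q e \<longleftrightarrow> (\<exists>s. T (case_nat s e))"
    using assms(2) unfolding semidecidable_def by blast
  have "semidecidable (\<lambda>e. \<exists>s t. R (case_nat s e) \<and> T (case_nat t e))"
    by (intro semidecidable_ex semidecidable_if_decidable decidable_conj
        decidable_subst[OF R(1)] decidable_subst[OF T(1)] recursive_case_nat recursive_proj)
  then show ?thesis by (simp add: R(2) T(2))
qed

lemma semidecidable_all_less [computability_intros]:
  assumes "recursive N" "semidecidable (\<lambda>e. P (e 0) (\<lambda>i. e (Suc i)))"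
  shows "semidecidable (\<lambda>e. \<forall>x<N e. P x e)"
proof -
  obtain R where R: "decidable R" and P: "\<And>x e. P x e \<longleftrightarrow> (\<exists>s. R (case_nat s (case_nat x e)))"
    using semidecidable_under_binder[OF assms(2)] by blast
  show ?thesis
    unfolding P all_less_ex_iff_ex_entry
    by (intro semidecidable_ex_decidable decidable_subst[OF R] computability_intros
        recursive_subst[OF assms(1)])
qed

lemma semidecidable_le_card [computability_intros]:
  assumes "recursive K" "recursive N" "semidecidable (\<lambda>e. P (e 0) (\<lambda>i. e (Suc i)))"
  shows "semidecidable (\<lambda>e. K e \<le> card {x. x < N e \<and> P x e})"
proof -
  obtain R where R: "decidable R" and P: "\<And>x e. P x e \<longleftrightarrow> (\<exists>s. R (case_nat s (case_nat x e)))"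
    using semidecidable_under_binder[OF assms(3)] by blast
  have card: "card {x. x < n \<and> Q x} = (\<Sum>x<n. of_bool (Q x))" for n and Q :: "nat \<Rightarrow> bool"
    by (simp add: Collect_conj_eq lessThan_def[symmetric])
  show ?thesis
    unfolding P le_card_ex_iff_ex_entry unfolding card
    by (intro semidecidable_ex_decidable decidable_subst[OF R] computability_intros
        recursive_subst[OF assms(1)] recursive_subst[OF assms(2)])
qed

subsection \<open>Computably enumerable sets\<close>

inductive_simps eval_Z_iff: "eval Z xs v"
inductive_simps eval_S_Nil_iff: "eval S [] v"
inductive_simps eval_S_Cons_iff: "eval S (x # xs) v"
inductive_simps eval_Proj_iff: "eval (Proj i) xs v"
inductive_simps eval_Comp_iff: "eval (Comp f gs) xs v"
inductive_simps eval_Prim_Nil_iff: "eval (Prim f g) [] v"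
inductive_simps eval_Prim_0_iff: "eval (Prim f g) (0 # xs) v"
inductive_simps eval_Prim_Suc_iff: "eval (Prim f g) (Suc y # xs) v"
inductive_simps eval_Mu_iff: "eval (Mu f) xs v"

lemma eval_deterministic: "eval f xs v \<Longrightarrow> eval f xs w \<Longrightarrow> v = w"
proof (induction arbitrary: w rule: eval.induct)
  case (eval_Comp xs gs ys f z)
  from eval_Comp.prems obtain ys' where "list_all2 (\<lambda>g y. eval g xs y) gs ys'" "eval f ys' w"
    unfolding eval_Comp_iff by blast
  moreover from this(1) eval_Comp.IH(1) have "ys = ys'"
    by (auto simp: list_all2_conv_all_nth intro!: nth_equalityI)
  ultimately show ?case using eval_Comp.IH(2) by blast
next
  case (eval_Mu f y xs)
  then have "eval f (w # xs) 0" "\<forall>z<w. \<exists>v>0. eval f (z # xs) v"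
    by (simp_all add: eval_Mu_iff)
  with eval_Mu.IH show ?case by (metis linorder_neqE_nat less_irrefl)
next
  case (eval_PrimS f g y xs r z)
  then show ?case by (metis eval_Prim_Suc_iff)
qed (simp_all add: eval_Z_iff eval_S_Cons_iff eval_Proj_iff eval_Prim_0_iff)

lemma eval_Prim_iff:
  "eval (Prim f g) (n # xs) v \<longleftrightarrow>
    (\<exists>c. eval f xs (entry c 0) \<and> (\<forall>y<n. eval g (entry c y # y # xs) (entry c (Suc y))) \<and>
      v = entry c n)"
proof
  assume "eval (Prim f g) (n # xs) v"
  then have "\<exists>r. eval f xs (r 0) \<and> (\<forall>y<n. eval g (r y # y # xs) (r (Suc y))) \<and> v = r n"
  proof (induction n arbitrary: v)
    case 0
    then show ?case by (intro exI[of _ "\<lambda>_. v"]) (simp add: eval_Prim_0_iff)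
  next
    case (Suc n)
    then obtain w where w: "eval (Prim f g) (n # xs) w" "eval g (w # n # xs) v"
      by (auto simp: eval_Prim_Suc_iff)
    from Suc.IH[OF w(1)] obtain r where
      "eval f xs (r 0)" "\<forall>y<n. eval g (r y # y # xs) (r (Suc y))" "w = r n" by blast
    with w(2) show ?case
      by (intro exI[of _ "r(Suc n := v)"]) (auto simp: less_Suc_eq)
  qed
  then obtain r where r:
    "eval f xs (r 0)" "\<forall>y<n. eval g (r y # y # xs) (r (Suc y))" "v = r n" by blast
  obtain c where "\<forall>y<Suc n. entry c y = r y" using ex_entry_eq by blast
  with r show "\<exists>c. eval f xs (entry c 0) \<and>
      (\<forall>y<n. eval g (entry c y # y # xs) (entry c (Suc y))) \<and> v = entry c n"
    by (intro exI[of _ c]) simp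
next
  assume "\<exists>c. eval f xs (entry c 0) \<and> (\<forall>y<n. eval g (entry c y # y # xs) (entry c (Suc y))) \<and>
    v = entry c n"
  then show "eval (Prim f g) (n # xs) v" using eval_Prim_if_trace by blast
qed

lemma eval_Comp_iff_entry:
  "eval (Comp f gs) xs v \<longleftrightarrow>
    (\<exists>c. (\<forall>i<length gs. eval (gs ! i) xs (entry c i)) \<and> eval f (map (entry c) [0..<length gs]) v)"
proof
  assume "eval (Comp f gs) xs v"
  then obtain ys where ys: "list_all2 (\<lambda>g y. eval g xs y) gs ys" "eval f ys v"
    unfolding eval_Comp_iff by blast
  obtain c where c: "\<forall>i<length gs. entry c i = ys ! i" using ex_entry_eq by blast
  then have "map (entry c) [0..<length gs] = ys"
    using ys(1) by (auto simp: list_all2_conv_all_nth intro: nth_equalityI)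
  with c ys show "\<exists>c. (\<forall>i<length gs. eval (gs ! i) xs (entry c i)) \<and>
      eval f (map (entry c) [0..<length gs]) v"
    by (intro exI[of _ c]) (simp add: list_all2_conv_all_nth)
next
  assume "\<exists>c. (\<forall>i<length gs. eval (gs ! i) xs (entry c i)) \<and>
      eval f (map (entry c) [0..<length gs]) v"
  then obtain c where "\<forall>i<length gs. eval (gs ! i) xs (entry c i)"
      and c: "eval f (map (entry c) [0..<length gs]) v" by blast
  then have "list_all2 (\<lambda>g y. eval g xs y) gs (map (entry c) [0..<length gs])"
    by (simp add: list_all2_conv_all_nth)
  from eval_Comp[OF this c] show "eval (Comp f gs) xs v" .
qed

inductive recursive_list :: "(env \<Rightarrow> nat list) \<Rightarrow> bool" where
  recursive_list_Nil: "recursive_list (\<lambda>e. [])"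
| recursive_list_Cons: "recursive X \<Longrightarrow> recursive_list L \<Longrightarrow> recursive_list (\<lambda>e. X e # L e)"

lemma recursive_list_subst:
  assumes "recursive_list L" and "\<And>i. recursive (\<lambda>e. E e i)"
  shows "recursive_list (\<lambda>e. L (E e))"
  using assms(1)
  by induction (intro recursive_list.intros recursive_subst[OF _ assms(2)]; assumption)+

lemma recursive_list_map:
  assumes "\<And>x. recursive (\<lambda>e. F e x)"
  shows "recursive_list (\<lambda>e. map (F e) xs)"
  by (induction xs) (auto intro: recursive_list.intros assms)

lemma decidable_eq_nth:
  assumes "recursive_list L" "recursive V"
  shows "decidable (\<lambda>e. V e = L e ! i \<and> i < length (L e))"
  using assms(1)
proof (induction arbitrary: i)
  case recursive_list_Nil
  show ?case by (simp add: decidable_const)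
next
  case (recursive_list_Cons X L)
  then show ?case
    by (cases i) (simp_all add: decidable_eq assms(2))
qed

lemma semidecidable_all_less_const:
  fixes k :: nat
  assumes "\<And>i. i < k \<Longrightarrow> semidecidable (P i)"
  shows "semidecidable (\<lambda>e. \<forall>i<k. P i e)"
  using assms
proof (induction k)
  case 0
  then show ?case by (simp add: semidecidable_if_decidable decidable_const)
next
  case (Suc k)
  have "semidecidable (\<lambda>e. P k e \<and> (\<forall>i<k. P i e))"
    by (intro semidecidable_conj Suc) simp_all
  then show ?case by (simp add: All_less_Suc)
qed

definition semidecidable_graph :: "recf \<Rightarrow> bool" where
  "semidecidable_graph f \<longleftrightarrow>
     (\<forall>L V. recursive_list L \<longrightarrow> recursive V \<longrightarrow> semidecidable (\<lambda>e. eval f (L e) (V e)))"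

lemma semidecidable_graphD:
  "semidecidable_graph f \<Longrightarrow> recursive_list L \<Longrightarrow> recursive V \<Longrightarrow>
    semidecidable (\<lambda>e. eval f (L e) (V e))"
  by (simp add: semidecidable_graph_def)

lemma semidecidable_graph_S: "semidecidable_graph S"
  unfolding semidecidable_graph_def
proof (intro allI impI)
  fix L V assume "recursive_list L" and V: "recursive V"
  from this(1) show "semidecidable (\<lambda>e. eval S (L e) (V e))"
  proof cases
    case recursive_list_Nil
    then show ?thesis by (simp add: eval_S_Nil_iff semidecidable_if_decidable decidable_const)
  next
    case (recursive_list_Cons X M)
    then show ?thesis
      using V unfolding recursive_list_Cons eval_S_Cons_iff
      by (intro semidecidable_if_decidable computability_intros)
  qed
qed

lemma semidecidable_graph_Comp:
  assumes "semidecidable_graph f" and "\<And>g. g \<in> set gs \<Longrightarrow> semidecidable_graph g"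
  shows "semidecidable_graph (Comp f gs)"
  unfolding semidecidable_graph_def
proof (intro allI impI)
  fix L V assume L: "recursive_list L" and V: "recursive V"
  show "semidecidable (\<lambda>e. eval (Comp f gs) (L e) (V e))"
    unfolding eval_Comp_iff_entry
    by (intro semidecidable_graphD[OF assms(1)] semidecidable_graphD[OF assms(2)] semidecidable_ex
        semidecidable_conj semidecidable_all_less_const nth_mem recursive_list_map
        recursive_list_subst[OF L] recursive_subst[OF V] recursive_entry recursive_proj
        recursive_const)
qed

lemma semidecidable_graph_Prim:
  assumes "semidecidable_graph f" "semidecidable_graph g"
  shows "semidecidable_graph (Prim f g)"
  unfolding semidecidable_graph_def
proof (intro allI impI)
  fix L V assume "recursive_list L" and V: "recursive V"
  from this(1) show "semidecidable (\<lambda>e. eval (Prim f g) (L e) (V e))"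
  proof cases
    case recursive_list_Nil
    then show ?thesis by (simp add: eval_Prim_Nil_iff semidecidable_if_decidable decidable_const)
  next
    case (recursive_list_Cons N M)
    show ?thesis
      unfolding recursive_list_Cons(1) eval_Prim_iff
      by (intro semidecidable_graphD[OF assms(1)] semidecidable_graphD[OF assms(2)]
          semidecidable_ex semidecidable_conj semidecidable_all_less recursive_list.intros
          recursive_list_subst[OF recursive_list_Cons(3)]
          semidecidable_if_decidable[OF decidable_eq] computability_intros
          recursive_subst[OF recursive_list_Cons(2)] recursive_subst[OF V])
  qed
qed

lemma semidecidable_graph_Mu:
  assumes "semidecidable_graph f"
  shows "semidecidable_graph (Mu f)"
  unfolding semidecidable_graph_def
proof (intro allI impI)
  fix L V assume L: "recursive_list L" and V: "recursive V"
  show "semidecidable (\<lambda>e. eval (Mu f) (L e) (V e))"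
    unfolding eval_Mu_iff
    by (intro semidecidable_graphD[OF assms] semidecidable_conj semidecidable_all_less
        semidecidable_ex semidecidable_if_decidable[OF decidable_less] recursive_list_Cons
        recursive_list_subst[OF L] recursive_subst[OF V] L V recursive_proj recursive_const)
qed

lemma semidecidable_graph: "semidecidable_graph f"
proof (induction f)
  case Z
  show ?case
    unfolding semidecidable_graph_def eval_Z_iff
    by (intro allI impI semidecidable_if_decidable computability_intros)
next
  case (Proj i)
  show ?case
    unfolding semidecidable_graph_def eval_Proj_iff
    by (intro allI impI semidecidable_if_decidable decidable_eq_nth)
qed (auto intro: semidecidable_graph_S semidecidable_graph_Comp semidecidable_graph_Prim
    semidecidable_graph_Mu)

lemma recursive_imp_eval:
  assumes "recursive F"
  shows "\<exists>f. \<forall>xs. length xs = k \<longrightarrow> eval f xs (F (\<lambda>i. if i < k then xs ! i else 0))"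
proof -
  obtain f n where f: "\<And>m e. m \<ge> n \<Longrightarrow> eval f (map e [0..<m]) (F e)"
    using assms unfolding recursive_def by blast
  have "eval (Comp f (map Proj [0..<k] @ replicate n Z)) xs (F (\<lambda>i. if i < k then xs ! i else 0))"
    if xs: "length xs = k" for xs
  proof (rule eval_Comp)
    let ?pad = "\<lambda>i. if i < k then xs ! i else 0"
    show "list_all2 (\<lambda>g y. eval g xs y) (map Proj [0..<k] @ replicate n Z) (map ?pad [0..<k + n])"
      using xs by (auto simp: list_all2_conv_all_nth nth_append eval_Proj_iff eval_Z_iff)
  qed (simp add: f)
  then show ?thesis by blast
qed

lemma ce_set_iff_semidecidable: "ce_set A \<longleftrightarrow> semidecidable (\<lambda>e. e 0 \<in> A)"
proof
  assume "ce_set A"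
  then obtain f where f: "\<And>n. n \<in> A \<longleftrightarrow> (\<exists>v. eval f [n] v)"
    unfolding ce_set_def by blast
  show "semidecidable (\<lambda>e. e 0 \<in> A)"
    unfolding f
    by (intro semidecidable_ex semidecidable_graphD[OF semidecidable_graph] recursive_list.intros
        recursive_proj)
next
  assume "semidecidable (\<lambda>e. e 0 \<in> A)"
  then obtain R where R: "decidable R" "\<And>e. e 0 \<in> A \<longleftrightarrow> (\<exists>s. R (case_nat s e))"
    unfolding semidecidable_def by blast
  define Q where "Q s n \<longleftrightarrow> R (\<lambda>i. if i < 2 then [s, n] ! i else 0)" for s n
  have A: "n \<in> A \<longleftrightarrow> (\<exists>s. Q s n)" for n
  proof -
    have "case_nat s (\<lambda>i. if i = 0 then n else 0) = (\<lambda>i. if i < 2 then [s, n] ! i else 0)" for s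
      by (auto simp: fun_eq_iff nth_Cons split: nat.splits)
    then show ?thesis using R(2)[of "\<lambda>i. if i = 0 then n else 0"] by (simp add: Q_def)
  qed
  have "recursive (\<lambda>e. of_bool (\<not> R e))"
    by (intro computability_intros R(1))
  then obtain f where
    "\<forall>xs. length xs = 2 \<longrightarrow> eval f xs (of_bool (\<not> R (\<lambda>i. if i < 2 then xs ! i else 0)))"
    using recursive_imp_eval by blast
  then have "eval f [s, n] (of_bool (\<not> Q s n))" for s n
    by (simp add: Q_def)
  then have f: "eval f [s, n] v \<longleftrightarrow> v = of_bool (\<not> Q s n)" for s n v
    using eval_deterministic by blast
  have "n \<in> A \<longleftrightarrow> (\<exists>s. eval (Mu f) [n] s)" for n
    unfolding eval_Mu_iff f A by (subst exists_least_iff) auto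
  then show "ce_set A" unfolding ce_set_def by blast
qed

lemma semidecidable_mem_ce_set:
  assumes "ce_set A" "recursive F"
  shows "semidecidable (\<lambda>e. F e \<in> A)"
  using semidecidable_subst[OF assms(1)[unfolded ce_set_iff_semidecidable], of "\<lambda>e _. F e"] assms(2)
  by simp

instance recf :: countable
  by countable_datatype

lemma countable_ce_set: "countable {A. ce_set A}"
proof (rule countable_subset)
  show "{A. ce_set A} \<subseteq> range (\<lambda>f. {n. \<exists>v. eval f [n] v})"
    by (auto simp: ce_set_def)
qed simp

section \<open>Computability on binary strings\<close>

lemma str_code_append: "str_code (xs @ ys) = str_code xs + 2 ^ length xs * str_code ys"
  by (induction xs) (auto simp: algebra_simps)

lemma str_code_bounds: "2 ^ length xs \<le> Suc (str_code xs)" "Suc (str_code xs) < 2 ^ Suc (length xs)"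
  by (induction xs) auto

lemma length_le_str_code: "length xs \<le> str_code xs"
  using str_code_bounds(1)[of xs] less_exp[of "length xs"] by linarith

lemma length_eq_iff_str_code:
  "length xs = n \<longleftrightarrow> 2 ^ n \<le> Suc (str_code xs) \<and> Suc (str_code xs) < 2 ^ Suc n"
proof
  assume "2 ^ n \<le> Suc (str_code xs) \<and> Suc (str_code xs) < 2 ^ Suc n"
  then have "(2::nat) ^ n < 2 ^ Suc (length xs)" "(2::nat) ^ length xs < 2 ^ Suc n"
    using str_code_bounds[of xs] by linarith+
  then show "length xs = n" by (simp only: power_strict_increasing_iff)
qed (use str_code_bounds in blast)

lemma inj_str_code: "inj str_code"
proof (rule injI)
  show "str_code xs = str_code ys \<Longrightarrow> xs = ys" for xs ys
  proof (induction xs arbitrary: ys)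
    case Nil
    then show ?case by (cases ys) (auto split: if_splits)
  next
    case (Cons b xs)
    then obtain c zs where ys: "ys = c # zs" by (cases ys) (auto split: if_splits)
    have "b = c" using Cons.prems unfolding ys by (auto split: if_splits) presburger+
    then show ?case using Cons unfolding ys by auto
  qed
qed

lemma surj_str_code: "surj str_code"
proof -
  have "\<exists>xs. n = str_code xs" for n
  proof (induction n rule: less_induct)
    case (less n)
    show ?case
    proof (cases "n = 0")
      case True
      then show ?thesis by (intro exI[of _ "[]"]) simp
    next
      case False
      then have "(n - 1) div 2 < n" by auto
      then obtain xs where "str_code xs = (n - 1) div 2"
        using less.IH by metis
      moreover have "n = 2 * ((n - 1) div 2) + (if even n then 2 else 1)"
        using False by presburger
      ultimately have "n = str_code (even n # xs)" by simp
      then show ?thesis by blast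
    qed
  qed
  then show ?thesis by (simp add: surj_def)
qed

definition str :: "nat \<Rightarrow> bool list" where
  "str = inv str_code"

lemma str_str_code [simp]: "str (str_code xs) = xs"
  by (simp add: str_def inj_str_code)

lemma str_code_str [simp]: "str_code (str n) = n"
  by (simp add: str_def surj_str_code surj_f_inv_f)

lemma recursive_length [computability_intros]:
  assumes "recursive F"
  shows "recursive (\<lambda>e. length (str (F e)))"
proof (rule recursive_if_decidable_graph[where B = F])
  show "decidable (\<lambda>e. 2 ^ e 0 \<le> Suc (F (\<lambda>i. e (Suc i))) \<and> Suc (F (\<lambda>i. e (Suc i))) < 2 ^ Suc (e 0))"
    by (intro computability_intros recursive_subst[OF assms])
  show "2 ^ n \<le> Suc (F e) \<and> Suc (F e) < 2 ^ Suc n \<longleftrightarrow> n = length (str (F e))" for n e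
    using length_eq_iff_str_code[of "str (F e)" n] by auto
  show "length (str (F e)) \<le> F e" for e
    using length_le_str_code[of "str (F e)"] by simp
qed (fact assms)

lemma prefix_iff_str_code:
  "prefix xs ys \<longleftrightarrow> (\<exists>r<Suc (str_code ys). str_code ys = str_code xs + 2 ^ length xs * r)"
proof
  assume "prefix xs ys"
  then obtain zs where "ys = xs @ zs" by (auto elim: prefixE)
  then have ys: "str_code ys = str_code xs + 2 ^ length xs * str_code zs"
    by (simp add: str_code_append)
  moreover have "str_code zs \<le> 2 ^ length xs * str_code zs" by simp
  ultimately have "str_code zs < Suc (str_code ys)" by linarith
  with ys show "\<exists>r<Suc (str_code ys). str_code ys = str_code xs + 2 ^ length xs * r" by blast
next
  assume "\<exists>r<Suc (str_code ys). str_code ys = str_code xs + 2 ^ length xs * r"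
  then obtain r where "str_code ys = str_code xs + 2 ^ length xs * r" by blast
  then have "str_code ys = str_code (xs @ str r)" by (simp add: str_code_append)
  then show "prefix xs ys" using inj_str_code by (auto dest: injD)
qed

lemma decidable_prefix [computability_intros]:
  assumes "recursive F" "recursive G"
  shows "decidable (\<lambda>e. prefix (str (F e)) (str (G e)))"
  unfolding prefix_iff_str_code str_code_str
  by (intro computability_intros recursive_subst[OF assms(1)] recursive_subst[OF assms(2)])

lemma ex_str_iff: "(\<exists>xs. P xs) \<longleftrightarrow> (\<exists>n. P (str n))"
  by (metis str_str_code)

lemma semidecidable_ex_str [computability_intros]:
  assumes "semidecidable (\<lambda>e. P (str (e 0)) (\<lambda>i. e (Suc i)))"
  shows "semidecidable (\<lambda>e. \<exists>xs. P xs e)"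
  unfolding ex_str_iff using assms by (rule semidecidable_ex)

lemma inj_prod_encode_map: "inj f \<Longrightarrow> inj g \<Longrightarrow> inj (\<lambda>(x, y). prod_encode (f x, g y))"
  by (auto simp: inj_def)

lemma semidecidable_mem_strpairs [computability_intros]:
  assumes "ce_strpairs R" "recursive F" "recursive G"
  shows "semidecidable (\<lambda>e. (str (F e), str (G e)) \<in> R)"
proof -
  let ?enc = "\<lambda>(a, b). prod_encode (str_code a, str_code b)"
  have "semidecidable (\<lambda>e. prod_encode (F e, G e) \<in> ?enc ` R)"
    by (rule semidecidable_mem_ce_set[OF assms(1)[unfolded ce_strpairs_def]])
      (intro computability_intros assms)
  moreover have "prod_encode (F e, G e) \<in> ?enc ` R \<longleftrightarrow> (str (F e), str (G e)) \<in> R" for e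
    using inj_image_mem_iff[OF inj_prod_encode_map[OF inj_str_code inj_str_code],
        of "(str (F e), str (G e))" R] by simp
  ultimately show ?thesis by simp
qed

lemma mem_natstr_code_iff:
  "n \<in> (\<lambda>(i, b). prod_encode (i, str_code b)) ` R \<longleftrightarrow>
    (fst (prod_decode n), str (snd (prod_decode n))) \<in> R"
  using inj_image_mem_iff[OF inj_prod_encode_map[OF inj_on_id2 inj_str_code],
      of "(fst (prod_decode n), str (snd (prod_decode n)))" R] by simp

lemma semidecidable_mem_natstr [computability_intros]:
  assumes "ce_natstr R" "recursive F" "recursive G"
  shows "semidecidable (\<lambda>e. (F e, str (G e)) \<in> R)"
proof -
  have "semidecidable (\<lambda>e. prod_encode (F e, G e) \<in> (\<lambda>(i, b). prod_encode (i, str_code b)) ` R)"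
    by (rule semidecidable_mem_ce_set[OF assms(1)[unfolded ce_natstr_def]])
      (intro computability_intros assms)
  then show ?thesis by (simp add: mem_natstr_code_iff)
qed

lemma ce_natstrI:
  assumes "semidecidable (\<lambda>e. (e 0, str (e (Suc 0))) \<in> R)"
  shows "ce_natstr R"
proof -
  have "semidecidable (\<lambda>e. (fst (prod_decode (e 0)), str (snd (prod_decode (e 0)))) \<in> R)"
    using semidecidable_subst[OF assms,
        of "\<lambda>e. case_nat (fst (prod_decode (e 0))) (\<lambda>_. snd (prod_decode (e 0)))"]
    by (simp add: computability_intros)
  then show ?thesis
    unfolding ce_natstr_def ce_set_iff_semidecidable mem_natstr_code_iff .
qed

lemma countable_ce_natstr: "countable {W. ce_natstr W}"
proof -
  let ?enc = "\<lambda>(i :: nat, b). prod_encode (i, str_code b)"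
  have "inj ?enc"
    by (rule inj_prod_encode_map[OF inj_on_id2 inj_str_code])
  then have "inj_on ((`) ?enc) {W. ce_natstr W}"
    by (simp add: inj_on_def inj_image_eq_iff)
  moreover have "countable ((`) ?enc ` {W. ce_natstr W})"
    by (rule countable_subset[OF _ countable_ce_set]) (auto simp: ce_natstr_def)
  ultimately show ?thesis by (rule countable_image_inj_on[rotated])
qed

section \<open>Open subsets of Cantor space\<close>

lemma prefix_of_iff_map: "prefix_of xs X \<longleftrightarrow> map X [0..<length xs] = xs"
  unfolding prefix_of_def by (subst list_eq_iff_nth_eq) simp

lemma prefix_of_map: "prefix_of (map X [0..<n]) X"
  by (simp add: prefix_of_def)

lemma prefix_of_prefix: "prefix xs ys \<Longrightarrow> prefix_of ys X \<Longrightarrow> prefix_of xs X"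
  by (auto simp: prefix_of_def prefix_def nth_append)

lemma prefix_of_imp_prefix:
  assumes "prefix_of xs X" "prefix_of ys X" "length xs \<le> length ys"
  shows "prefix xs ys"
proof -
  have "take (length xs) ys = xs"
    using assms by (auto simp: prefix_of_def list_eq_iff_nth_eq)
  then show ?thesis by (metis take_is_prefix)
qed

lemma prefix_of_not_parallel: "prefix_of xs X \<Longrightarrow> prefix_of ys X \<Longrightarrow> \<not> xs \<parallel> ys"
  using prefix_of_imp_prefix nat_le_linear by blast

lemma prefix_map_iff: "prefix xs (map X [0..<n]) \<longleftrightarrow> length xs \<le> n \<and> prefix_of xs X"
  using prefix_of_prefix[OF _ prefix_of_map] prefix_of_imp_prefix[OF _ prefix_of_map]
  by (metis diff_zero length_map length_upt prefix_length_le)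

definition open_of :: "bool list set \<Rightarrow> (nat \<Rightarrow> bool) set" where
  "open_of A = (\<Union>xs\<in>A. cyl xs)"

lemma mem_open_of: "X \<in> open_of A \<longleftrightarrow> (\<exists>xs\<in>A. prefix_of xs X)"
  by (simp add: open_of_def cyl_def)

lemma eff_open_eq_open_of: "eff_open W i = open_of {xs. (i, xs) \<in> W}"
  by (simp add: eff_open_def open_of_def)

lemma open_of_Int:
  "open_of A \<inter> open_of B = open_of {xs. (\<exists>a\<in>A. prefix a xs) \<and> (\<exists>b\<in>B. prefix b xs)}"
proof (intro equalityI subsetI)
  fix X assume "X \<in> open_of A \<inter> open_of B"
  then obtain a b where ab: "a \<in> A" "prefix_of a X" "b \<in> B" "prefix_of b X"
    by (auto simp: mem_open_of)
  let ?xs = "map X [0..<max (length a) (length b)]"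
  have "prefix a ?xs" "prefix b ?xs"
    using ab by (simp_all add: prefix_map_iff)
  then show "X \<in> open_of {xs. (\<exists>a\<in>A. prefix a xs) \<and> (\<exists>b\<in>B. prefix b xs)}"
    using ab prefix_of_map by (auto simp: mem_open_of)
qed (auto simp: mem_open_of dest: prefix_of_prefix)

lemma open_cyl: "open (cyl xs)"
proof -
  have "open ((\<lambda>X :: nat \<Rightarrow> bool. X i) -` {b})" for i b
    by (rule open_vimage[OF Topological_Spaces.open_discrete continuous_on_product_coordinates])
  then have "open (\<Inter>i<length xs. (\<lambda>X :: nat \<Rightarrow> bool. X i) -` {xs ! i})"
    by (intro open_INT) blast+
  moreover have "cyl xs = (\<Inter>i<length xs. (\<lambda>X. X i) -` {xs ! i})"
    by (auto simp: cyl_def prefix_of_def)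
  ultimately show ?thesis by (simp only:)
qed

lemma open_open_of: "open (open_of A)"
  unfolding open_of_def by (intro open_UN ballI open_cyl)

lemma compact_UNIV_nat_bool: "compact (UNIV :: (nat \<Rightarrow> bool) set)"
proof -
  have "compact_space (product_topology (\<lambda>i::nat. euclidean :: bool topology) UNIV)"
    unfolding compact_space_product_topology
    by (auto simp: compact_space_def finite_imp_compact)
  then show ?thesis
    by (simp add: euclidean_product_topology compact_space_def)
qed

lemma compact_subset_incseq_open:
  fixes U :: "nat \<Rightarrow> 'a::topological_space set"
  assumes "compact K" "\<And>n. open (U n)" "incseq U" "K \<subseteq> (\<Union>n. U n)"
  shows "\<exists>n. K \<subseteq> U n"
proof -
  obtain F where F: "finite F" "K \<subseteq> (\<Union>n\<in>F. U n)"
    using compactE_image[OF assms(1), of UNIV U] assms(2,4) by auto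
  obtain m where "F \<subseteq> {..m}" using F(1) finite_nat_iff_bounded_le by blast
  then have "(\<Union>n\<in>F. U n) \<subseteq> U m"
    by (intro UN_least incseqD[OF assms(3)]) auto
  with F(2) show ?thesis by blast
qed

section \<open>The uniform measure\<close>

interpretation coins: product_prob_space
  "\<lambda>_. measure_pmf (pmf_of_set (UNIV :: bool set))" "UNIV :: nat set"
  by unfold_locales

interpretation cantor: prob_space cantor
  unfolding cantor_def by (rule coins.prob_space_axioms)

lemma space_cantor [simp]: "space cantor = UNIV"
  by (simp add: cantor_def space_PiM)

lemma cyl_eq_prod_emb:
  "cyl xs = prod_emb UNIV (\<lambda>_. measure_pmf (pmf_of_set UNIV)) {..<length xs}
     (PiE {..<length xs} (\<lambda>i. {xs ! i}))"
  unfolding cyl_def prefix_of_def prod_emb_def vimage_def restrict_PiE_iff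
  by (simp add: Ball_def)

lemma sets_cyl [measurable]: "cyl xs \<in> sets cantor"
  unfolding cyl_eq_prod_emb cantor_def by (rule sets_PiM_I) auto

lemma measure_cyl: "measure cantor (cyl xs) = (1 / 2) ^ length xs"
proof -
  have "measure cantor (cyl xs) =
      (\<Prod>i<length xs. measure (measure_pmf (pmf_of_set (UNIV :: bool set))) {xs ! i})"
    unfolding cyl_eq_prod_emb cantor_def by (rule coins.measure_PiM_emb) auto
  also have "\<dots> = (\<Prod>i<length xs. 1 / 2)"
    by (rule prod.cong) (auto simp: measure_pmf_single)
  finally show ?thesis by simp
qed

lemma sets_open_of [measurable]: "open_of A \<in> sets cantor"
  unfolding open_of_def by (intro sets.countable_UN'') auto

lemma sets_eff_open [measurable]: "eff_open W i \<in> sets cantor"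
  by (simp add: eff_open_eq_open_of)

lemma map_in_eq_UN_cyl: "{X. map X [0..<n] \<in> A} = (\<Union>xs\<in>{xs \<in> A. length xs = n}. cyl xs)"
  by (auto simp: cyl_def prefix_of_iff_map)

lemma sets_map_in [measurable]: "{X. map X [0..<n] \<in> A} \<in> sets cantor"
  unfolding map_in_eq_UN_cyl by (intro sets.countable_UN'') auto

lemma measure_map_in: "measure cantor {X. map X [0..<n] \<in> A} = card {xs \<in> A. length xs = n} / 2 ^ n"
proof -
  have "finite {xs \<in> A. length xs = n}"
    by (rule finite_subset[OF _ finite_list_length[of n]]) auto
  moreover have "disjoint_family_on cyl {xs \<in> A. length xs = n}"
    by (auto simp: disjoint_family_on_def cyl_def prefix_of_iff_map)
  ultimately have "measure cantor {X. map X [0..<n] \<in> A} =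
      (\<Sum>xs\<in>{xs \<in> A. length xs = n}. measure cantor (cyl xs))"
    unfolding map_in_eq_UN_cyl by (intro cantor.finite_measure_finite_Union) auto
  also have "\<dots> = (\<Sum>xs\<in>{xs \<in> A. length xs = n}. (1 / 2) ^ n)"
    by (rule sum.cong) (auto simp: measure_cyl)
  finally show ?thesis by (simp add: field_simps)
qed

lemma less_measure_open_of_iff:
  "r < measure cantor (open_of A) \<longleftrightarrow>
    (\<exists>n. r < card {xs. length xs = n \<and> (\<exists>a\<in>A. prefix a xs)} / 2 ^ n)"
proof -
  define C where "C n = {X. map X [0..<n] \<in> {xs. \<exists>a\<in>A. prefix a xs}}" for n
  have C: "C n = {X. \<exists>a\<in>A. length a \<le> n \<and> prefix_of a X}" for n
    by (simp add: C_def prefix_map_iff)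
  have "measure cantor (C n) = card {xs. length xs = n \<and> (\<exists>a\<in>A. prefix a xs)} / 2 ^ n" for n
    unfolding C_def measure_map_in by (simp add: conj_commute)
  moreover have "r < measure cantor (open_of A) \<longleftrightarrow> (\<exists>n. r < measure cantor (C n))"
  proof
    have "range C \<subseteq> sets cantor"
      unfolding C_def using sets_map_in by blast
    moreover have "incseq C"
      unfolding incseq_def C by (blast intro: order_trans)
    moreover have "(\<Union>n. C n) = open_of A"
      unfolding C set_eq_iff mem_open_of by blast
    ultimately have lim: "(\<lambda>n. measure cantor (C n)) \<longlonglongrightarrow> measure cantor (open_of A)"
      using cantor.finite_Lim_measure_incseq by metis
    assume "r < measure cantor (open_of A)"
    from order_tendstoD(1)[OF lim this] show "\<exists>n. r < measure cantor (C n)"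
      by (auto simp: eventually_sequentially)
  next
    have "measure cantor (C n) \<le> measure cantor (open_of A)" for n
      by (rule cantor.finite_measure_mono) (auto simp: C mem_open_of)
    then show "\<exists>n. r < measure cantor (C n) \<Longrightarrow> r < measure cantor (open_of A)"
      using order_less_le_trans by blast
  qed
  ultimately show ?thesis by simp
qed

lemma card_strings_eq_card_codes:
  "card {xs. length xs = n \<and> P xs} = card {c. c < 2 ^ Suc n \<and> length (str c) = n \<and> P (str c)}"
proof (rule bij_betw_same_card[of str_code])
  show "bij_betw str_code {xs. length xs = n \<and> P xs}
      {c. c < 2 ^ Suc n \<and> length (str c) = n \<and> P (str c)}"
    by (intro bij_betwI[where g = str]) (use str_code_bounds in \<open>auto intro: Suc_lessD\<close>)
qed

lemma semidecidable_less_measure_open_of: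
  assumes A: "semidecidable (\<lambda>e. str (e 0) \<in> A (\<lambda>i. e (Suc i)))" and "recursive M" "recursive N"
  shows "semidecidable (\<lambda>e. M e < 2 ^ N e * measure cantor (open_of (A e)))"
proof -
  let ?card = "\<lambda>e n. card {c. c < 2 ^ Suc n \<and> length (str c) = n \<and>
    (\<exists>a. a \<in> A e \<and> prefix a (str c))}"
  have "M e < 2 ^ N e * measure cantor (open_of (A e)) \<longleftrightarrow>
      (\<exists>n k. k \<le> ?card e n \<and> M e * 2 ^ n < 2 ^ N e * k)" for e
  proof -
    have "M e < 2 ^ N e * measure cantor (open_of (A e)) \<longleftrightarrow>
        M e / 2 ^ N e < measure cantor (open_of (A e))"
      by (simp add: field_simps)
    also have "\<dots> \<longleftrightarrow> (\<exists>n. real (M e) / 2 ^ N e < ?card e n / 2 ^ n)"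
      unfolding less_measure_open_of_iff card_strings_eq_card_codes by (simp add: Bex_def)
    also have "\<dots> \<longleftrightarrow> (\<exists>n. real (M e * 2 ^ n) < real (2 ^ N e * ?card e n))"
      by (simp add: field_simps)
    also have "\<dots> \<longleftrightarrow> (\<exists>n k. k \<le> ?card e n \<and> M e * 2 ^ n < 2 ^ N e * k)"
      unfolding of_nat_less_iff by (meson mult_le_mono2 order_less_le_trans order_refl)
    finally show ?thesis .
  qed
  moreover have "semidecidable (\<lambda>e. \<exists>n k. k \<le> ?card e n \<and> M e * 2 ^ n < 2 ^ N e * k)"
    by (intro computability_intros semidecidable_apply[OF A]
        semidecidable_if_decidable[OF decidable_less]
        semidecidable_if_decidable[OF decidable_eq] semidecidable_if_decidable[OF decidable_prefix]
        recursive_subst[OF assms(2)] recursive_subst[OF assms(3)])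
  ultimately show ?thesis by simp
qed

section \<open>Weak 2-randomness\<close>

definition W2R_test :: "(nat \<Rightarrow> bool) measure \<Rightarrow> (nat \<times> bool list) set \<Rightarrow> bool" where
  "W2R_test \<mu> W \<longleftrightarrow> ce_natstr W \<and> (\<lambda>i. measure \<mu> (eff_open W i)) \<longlonglongrightarrow> 0"

lemma W2R_iff: "X \<in> W2R \<mu> \<longleftrightarrow> (\<forall>W. W2R_test \<mu> W \<longrightarrow> (\<exists>i. X \<notin> eff_open W i))"
  by (auto simp: W2R_def W2R_test_def)

lemma W2R_test_empty: "W2R_test \<mu> {}"
  by (auto simp: W2R_test_def eff_open_def
      intro!: ce_natstrI semidecidable_if_decidable decidable_const)

lemma countable_W2R_tests: "countable {W. W2R_test \<mu> W}"
  by (rule countable_subset[OF _ countable_ce_natstr]) (auto simp: W2R_test_def)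

lemma W2R_measure_cyl_pos:
  assumes "Y \<in> W2R \<mu>" "prefix_of xs Y"
  shows "0 < measure \<mu> (cyl xs)"
proof (rule ccontr)
  assume "\<not> 0 < measure \<mu> (cyl xs)"
  then have null: "measure \<mu> (cyl xs) = 0" by (simp add: zero_less_measure_iff)
  define W where "W = {(i :: nat, ys). ys = xs}"
  have W: "eff_open W i = cyl xs" for i by (auto simp: eff_open_def W_def)
  have "str c = xs \<longleftrightarrow> c = str_code xs" for c by auto
  moreover have "semidecidable (\<lambda>e. e (Suc 0) = str_code xs)"
    by (intro semidecidable_if_decidable computability_intros)
  ultimately have "ce_natstr W"
    by (intro ce_natstrI) (simp add: W_def)
  then have "W2R_test \<mu> W" by (simp add: W2R_test_def W null)
  then show False using assms by (auto simp: W2R_iff W cyl_def)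
qed

lemma ex_decseq_eff_open_Inter_eq_Compl:
  assumes "semidecidable (\<lambda>e. str (e 0) \<in> A)"
  shows "\<exists>W. ce_natstr W \<and> decseq (eff_open W) \<and> (\<Inter>i. eff_open W i) = - open_of A"
proof -
  obtain R where R: "decidable R" "\<And>e. str (e 0) \<in> A \<longleftrightarrow> (\<exists>s. R (case_nat s e))"
    using assms unfolding semidecidable_def by blast
  define Q where "Q c s \<longleftrightarrow> R (case_nat s (\<lambda>_. c))" for c s
  define W where "W = {(i, xs). length xs = i \<and> (\<forall>c<i. \<forall>s<i. \<not> (Q c s \<and> prefix (str c) xs))}"
  have "semidecidable (\<lambda>e. (e 0, str (e (Suc 0))) \<in> W)"
    unfolding W_def mem_Collect_eq prod.case Q_def
    by (intro semidecidable_if_decidable decidable_subst[OF R(1)] computability_intros)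
  then have ce: "ce_natstr W" by (rule ce_natstrI)
  have W: "eff_open W i = {X. \<forall>c<i. \<forall>s<i. \<not> (Q c s \<and> prefix_of (str c) X)}" for i
  proof -
    have "X \<in> eff_open W i \<longleftrightarrow> (i, map X [0..<i]) \<in> W" for X
      by (auto simp: eff_open_def cyl_def prefix_of_iff_map W_def)
    moreover have "length (str c) \<le> i" if "c < i" for c
      using length_le_str_code[of "str c"] that by simp
    ultimately show ?thesis by (auto simp: W_def prefix_map_iff)
  qed
  have "decseq (eff_open W)"
    unfolding decseq_Suc_iff W by (auto intro: less_SucI)
  moreover have "(\<Inter>i. eff_open W i) = - open_of A"
  proof (rule set_eqI)
    fix X
    have "str c \<in> A \<longleftrightarrow> (\<exists>s. Q c s)" for c
      using R(2)[of "\<lambda>_. c"] by (simp add: Q_def)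
    then have "X \<in> - open_of A \<longleftrightarrow> (\<forall>c s. \<not> (Q c s \<and> prefix_of (str c) X))"
      unfolding Compl_iff mem_open_of Bex_def ex_str_iff by blast
    also have "\<dots> \<longleftrightarrow> (\<forall>i. \<forall>c<i. \<forall>s<i. \<not> (Q c s \<and> prefix_of (str c) X))"
    proof -
      have "\<exists>i. c < i \<and> s < i" for c s :: nat
        by (intro exI[of _ "Suc (c + s)"]) simp
      then show ?thesis by blast
    qed
    finally show "X \<in> (\<Inter>i. eff_open W i) \<longleftrightarrow> X \<in> - open_of A" by (simp add: W)
  qed
  ultimately show ?thesis using ce by blast
qed

lemma W2R_mem_open_of:
  assumes "finite_measure \<mu>" "sets \<mu> = sets cantor" "X \<in> W2R \<mu>"
    and "semidecidable (\<lambda>e. str (e 0) \<in> A)" "measure \<mu> (- open_of A) = 0"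
  shows "X \<in> open_of A"
proof -
  obtain W where W: "ce_natstr W" "decseq (eff_open W)" "(\<Inter>i. eff_open W i) = - open_of A"
    using ex_decseq_eff_open_Inter_eq_Compl[OF assms(4)] by blast
  have "(\<lambda>i. measure \<mu> (eff_open W i)) \<longlonglongrightarrow> measure \<mu> (\<Inter>i. eff_open W i)"
    by (rule finite_measure.finite_Lim_measure_decseq[OF assms(1) _ W(2)]) (auto simp: assms(2))
  then have "W2R_test \<mu> W" by (simp add: W2R_test_def W(1,3) assms(5))
  with assms(3) W(3) show ?thesis unfolding W2R_iff by blast
qed

section \<open>Turing functionals\<close>

abbreviation preimage :: "(bool list \<times> bool list) set \<Rightarrow> bool list \<Rightarrow> (nat \<Rightarrow> bool) set" where
  "preimage \<Phi> \<tau> \<equiv> {X. phi_ext \<Phi> X \<tau>}"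

definition incompat :: "(bool list \<times> bool list) set \<Rightarrow> bool list \<Rightarrow> (nat \<Rightarrow> bool) set" where
  "incompat \<Phi> \<tau> = {X. \<exists>\<rho>\<in>outs \<Phi> X. \<rho> \<parallel> \<tau>}"

lemma preimage_eq_open_of: "preimage \<Phi> \<tau> = open_of {\<alpha>. \<exists>\<rho>. (\<alpha>, \<rho>) \<in> \<Phi> \<and> prefix \<tau> \<rho>}"
  by (fastforce simp: phi_ext_def outs_def mem_open_of)

lemma incompat_eq_open_of: "incompat \<Phi> \<tau> = open_of {\<alpha>. \<exists>\<rho>. (\<alpha>, \<rho>) \<in> \<Phi> \<and> \<rho> \<parallel> \<tau>}"
  by (fastforce simp: incompat_def outs_def mem_open_of)

lemma sets_preimage [measurable]: "preimage \<Phi> \<tau> \<in> sets cantor"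
  by (simp add: preimage_eq_open_of)

lemma sets_incompat [measurable]: "incompat \<Phi> \<tau> \<in> sets cantor"
  by (simp add: incompat_eq_open_of)

lemma outs_not_parallel:
  assumes "turing_functional \<Phi>" "\<rho> \<in> outs \<Phi> X" "\<rho>' \<in> outs \<Phi> X"
  shows "\<not> \<rho> \<parallel> \<rho>'"
proof -
  obtain \<alpha> \<alpha>' where \<alpha>: "(\<alpha>, \<rho>) \<in> \<Phi>" "prefix_of \<alpha> X" "(\<alpha>', \<rho>') \<in> \<Phi>" "prefix_of \<alpha>' X"
    using assms(2,3) unfolding outs_def by blast
  then have "prefix \<alpha> \<alpha>' \<or> prefix \<alpha>' \<alpha>"
    using prefix_of_not_parallel unfolding parallel_def by blast
  then show ?thesis
    using \<alpha> assms(1) unfolding turing_functional_def parallel_def by blast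
qed

lemma parallel_extension: "\<sigma> \<parallel> \<tau> \<Longrightarrow> prefix \<tau> \<rho> \<Longrightarrow> \<sigma> \<parallel> \<rho>"
  unfolding parallel_def by (meson prefix_order.trans prefix_same_cases)

lemma preimage_Int_incompat:
  assumes "turing_functional \<Phi>"
  shows "preimage \<Phi> \<tau> \<inter> incompat \<Phi> \<tau> = {}"
  using outs_not_parallel[OF assms] parallel_extension unfolding phi_ext_def incompat_def by blast

lemma preimage_Int_preimage:
  assumes "turing_functional \<Phi>" "\<sigma> \<parallel> \<tau>"
  shows "preimage \<Phi> \<sigma> \<inter> preimage \<Phi> \<tau> = {}"
proof -
  have "preimage \<Phi> \<sigma> \<subseteq> incompat \<Phi> \<tau>"
    using parallel_extension[of \<tau> \<sigma>] assms(2) parallel_commute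
    unfolding phi_ext_def incompat_def by blast
  then show ?thesis using preimage_Int_incompat[OF assms(1)] by blast
qed

lemma incompat_mono: "prefix \<sigma> \<tau> \<Longrightarrow> incompat \<Phi> \<sigma> \<subseteq> incompat \<Phi> \<tau>"
  unfolding incompat_def using parallel_extension by blast

lemma phi_dom_subset: "phi_dom \<Phi> \<subseteq> preimage \<Phi> \<tau> \<union> incompat \<Phi> \<tau>"
proof
  fix X assume "X \<in> phi_dom \<Phi>"
  then obtain \<rho> where \<rho>: "\<rho> \<in> outs \<Phi> X" "length \<tau> \<le> length \<rho>"
    unfolding phi_dom_def by blast
  have "prefix \<tau> \<rho> \<or> \<rho> \<parallel> \<tau>"
    using \<rho>(2) by (auto simp: parallel_def prefix_def)
  then show "X \<in> preimage \<Phi> \<tau> \<union> incompat \<Phi> \<tau>"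
    using \<rho>(1) unfolding phi_ext_def incompat_def by blast
qed

lemma phi_apply_eqI:
  assumes "X \<in> phi_dom \<Phi>" "\<And>n. X \<notin> incompat \<Phi> (map Y [0..<n])"
  shows "phi_apply \<Phi> X = Y"
proof
  fix n
  have val: "\<tau> ! n = Y n" if "\<tau> \<in> outs \<Phi> X" "n < length \<tau>" for \<tau>
  proof -
    have "\<not> \<tau> \<parallel> map Y [0..<Suc n]"
      using assms(2) that(1) unfolding incompat_def by blast
    moreover have "xs ! n = ys ! n" if "prefix xs ys" "n < length xs" for xs ys :: "bool list"
      using that by (auto simp: prefix_def nth_append)
    ultimately have "\<tau> ! n = map Y [0..<Suc n] ! n"
      using that(2) unfolding parallel_def by (metis diff_zero length_map length_upt lessI)
    then show ?thesis by (simp del: upt_Suc)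
  qed
  obtain \<tau> where "\<tau> \<in> outs \<Phi> X" "n < length \<tau>"
    using assms(1) unfolding phi_dom_def by (auto simp: Suc_le_eq dest: spec[of _ "Suc n"])
  with val show "phi_apply \<Phi> X n = Y n"
    unfolding phi_apply_def by (intro the_equality) blast+
qed

lemma measure_preimage_add_incompat:
  assumes "turing_functional \<Phi>" "almost_total \<Phi>"
  shows "measure cantor (preimage \<Phi> \<tau>) + measure cantor (incompat \<Phi> \<tau>) = 1"
proof -
  have "1 \<le> measure cantor (preimage \<Phi> \<tau> \<union> incompat \<Phi> \<tau>)"
    using cantor.finite_measure_mono[OF phi_dom_subset] assms(2)
    unfolding almost_total_def by (metis sets.Un sets_incompat sets_preimage)
  moreover have "measure cantor (preimage \<Phi> \<tau> \<union> incompat \<Phi> \<tau>) =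
      measure cantor (preimage \<Phi> \<tau>) + measure cantor (incompat \<Phi> \<tau>)"
    by (rule cantor.finite_measure_Union) (use preimage_Int_incompat[OF assms(1)] in auto)
  ultimately show ?thesis
    using cantor.prob_le_1[of "preimage \<Phi> \<tau> \<union> incompat \<Phi> \<tau>"] by linarith
qed

lemma W2R_phi_dom:
  assumes "turing_functional \<Phi>" "almost_total \<Phi>" "X \<in> W2R cantor"
  shows "X \<in> phi_dom \<Phi>"
  unfolding phi_dom_def mem_Collect_eq
proof
  fix n
  define A where "A = {\<alpha>. \<exists>\<rho>. (\<alpha>, \<rho>) \<in> \<Phi> \<and> n \<le> length \<rho>}"
  have A: "Z \<in> open_of A \<longleftrightarrow> (\<exists>\<tau>\<in>outs \<Phi> Z. n \<le> length \<tau>)" for Z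
    unfolding A_def outs_def mem_open_of by blast
  have "ce_strpairs \<Phi>" using assms(1) by (simp add: turing_functional_def)
  then have "semidecidable (\<lambda>e. str (e 0) \<in> A)"
    unfolding A_def mem_Collect_eq
    by (intro computability_intros semidecidable_if_decidable[OF decidable_le])
  moreover have "phi_dom \<Phi> \<subseteq> open_of A"
    using A by (auto simp: phi_dom_def)
  then have "1 \<le> measure cantor (open_of A)"
    using assms(2) cantor.finite_measure_mono[OF _ sets_open_of] unfolding almost_total_def by metis
  then have "measure cantor (- open_of A) = 0"
    using cantor.prob_compl[OF sets_open_of[of A]] cantor.prob_le_1[of "open_of A"]
    by (simp add: Compl_eq_Diff_UNIV)
  ultimately have "X \<in> open_of A"
    by (rule W2R_mem_open_of[OF cantor.finite_measure_axioms refl assms(3)])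
  then show "\<exists>\<tau>\<in>outs \<Phi> X. n \<le> length \<tau>" unfolding A .
qed

section \<open>The induced measure\<close>

definition induced_measure ::
    "(bool list \<times> bool list) set \<Rightarrow> (nat \<Rightarrow> bool) measure \<Rightarrow> bool" where
  "induced_measure \<Phi> \<mu> \<longleftrightarrow> sets \<mu> = sets cantor \<and>
     (\<forall>\<sigma>. emeasure \<mu> (cyl \<sigma>) = emeasure cantor (preimage \<Phi> \<sigma>))"

definition minimal_strings :: "bool list set \<Rightarrow> bool list set" where
  "minimal_strings A = {xs \<in> A. \<forall>ys. strict_prefix ys xs \<longrightarrow> ys \<notin> A}"

lemma minimal_strings_parallel:
  "xs \<in> minimal_strings A \<Longrightarrow> ys \<in> minimal_strings A \<Longrightarrow> xs \<noteq> ys \<Longrightarrow> xs \<parallel> ys"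
  unfolding minimal_strings_def parallel_def strict_prefix_def by blast

lemma ex_minimal_string_prefix: "xs \<in> A \<Longrightarrow> \<exists>ys\<in>minimal_strings A. prefix ys xs"
proof (induction "length xs" arbitrary: xs rule: less_induct)
  case less
  show ?case
  proof (cases "xs \<in> minimal_strings A")
    case False
    then obtain ys where ys: "strict_prefix ys xs" "ys \<in> A"
      using less.prems unfolding minimal_strings_def by blast
    from less.hyps[OF prefix_length_less[OF ys(1)] ys(2)] show ?thesis
      using ys(1) by (auto simp: strict_prefix_def intro: prefix_order.trans)
  qed auto
qed

lemma open_of_minimal_strings: "open_of (minimal_strings A) = open_of A"
proof
  show "open_of (minimal_strings A) \<subseteq> open_of A"
    by (auto simp: mem_open_of minimal_strings_def)
  show "open_of A \<subseteq> open_of (minimal_strings A)"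
    using ex_minimal_string_prefix prefix_of_prefix unfolding subset_iff mem_open_of by blast
qed

lemma emeasure_open_of:
  assumes "sets \<mu> = sets cantor"
  shows "emeasure \<mu> (open_of A) = (\<integral>\<^sup>+\<tau>. emeasure \<mu> (cyl \<tau>) \<partial>count_space (minimal_strings A))"
proof -
  have "disjoint_family_on cyl (minimal_strings A)"
    using minimal_strings_parallel prefix_of_not_parallel
    unfolding disjoint_family_on_def cyl_def by blast
  then have "emeasure \<mu> (open_of (minimal_strings A)) =
      (\<integral>\<^sup>+\<tau>. emeasure \<mu> (cyl \<tau>) \<partial>count_space (minimal_strings A))"
    unfolding open_of_def by (intro emeasure_UN_countable) (auto simp: assms)
  then show ?thesis by (simp only: open_of_minimal_strings)
qed

text \<open>The martingale maps \<open>\<tau>\<close> to the conditional probability of \<open>U\<close> given the preimage of \<open>\<tau>\<close>.\<close>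

lemma ville_maximal_inequality:
  assumes "turing_functional \<Phi>" "induced_measure \<Phi> \<mu>" "U \<in> sets cantor"
    and dense: "\<And>\<tau>. \<tau> \<in> A \<Longrightarrow>
      emeasure cantor (preimage \<Phi> \<tau>) \<le> c * emeasure cantor (U \<inter> preimage \<Phi> \<tau>)"
  shows "emeasure \<mu> (open_of A) \<le> c * emeasure cantor U"
proof -
  let ?M = "count_space (minimal_strings A)"
  have \<mu>: "sets \<mu> = sets cantor" "\<And>\<sigma>. emeasure \<mu> (cyl \<sigma>) = emeasure cantor (preimage \<Phi> \<sigma>)"
    using assms(2) by (auto simp: induced_measure_def)
  have "emeasure \<mu> (open_of A) = (\<integral>\<^sup>+\<tau>. emeasure cantor (preimage \<Phi> \<tau>) \<partial>?M)"
    using emeasure_open_of[OF \<mu>(1)] by (simp add: \<mu>(2))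
  also have "\<dots> \<le> (\<integral>\<^sup>+\<tau>. c * emeasure cantor (U \<inter> preimage \<Phi> \<tau>) \<partial>?M)"
    by (intro nn_integral_mono dense) (simp add: minimal_strings_def)
  also have "\<dots> = c * (\<integral>\<^sup>+\<tau>. emeasure cantor (U \<inter> preimage \<Phi> \<tau>) \<partial>?M)"
    by (rule nn_integral_cmult) simp
  also have "(\<integral>\<^sup>+\<tau>. emeasure cantor (U \<inter> preimage \<Phi> \<tau>) \<partial>?M) =
      emeasure cantor (\<Union>\<tau>\<in>minimal_strings A. U \<inter> preimage \<Phi> \<tau>)"
  proof (rule emeasure_UN_countable[symmetric])
    show "disjoint_family_on (\<lambda>\<tau>. U \<inter> preimage \<Phi> \<tau>) (minimal_strings A)"
      using minimal_strings_parallel preimage_Int_preimage[OF assms(1)]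
      unfolding disjoint_family_on_def by blast
  qed (auto simp: assms(3))
  also have "\<dots> \<le> emeasure cantor U"
    using assms(3) by (intro emeasure_mono) auto
  finally show ?thesis by (simp add: mult_left_mono)
qed

section \<open>Density tests\<close>

definition density_test ::
  "(bool list \<times> bool list) set \<Rightarrow> (nat \<times> bool list) set \<Rightarrow> nat \<Rightarrow> (nat \<times> bool list) set" where
  "density_test \<Phi> W k = {(i, \<tau>). measure cantor (preimage \<Phi> \<tau>) <
     2 ^ k * measure cantor (eff_open W i \<inter> preimage \<Phi> \<tau>)}"

lemma measure_density_test_le:
  assumes "turing_functional \<Phi>" "induced_measure \<Phi> \<mu>"
  shows "measure \<mu> (eff_open (density_test \<Phi> W k) i) \<le> 2 ^ k * measure cantor (eff_open W i)"
proof -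
  have "emeasure \<mu> (eff_open (density_test \<Phi> W k) i) \<le>
      ennreal (2 ^ k) * emeasure cantor (eff_open W i)"
    unfolding eff_open_eq_open_of[of "density_test \<Phi> W k"]
  proof (rule ville_maximal_inequality[OF assms sets_eff_open])
    show "emeasure cantor (preimage \<Phi> \<tau>) \<le>
        ennreal (2 ^ k) * emeasure cantor (eff_open W i \<inter> preimage \<Phi> \<tau>)"
      if "\<tau> \<in> {\<tau>. (i, \<tau>) \<in> density_test \<Phi> W k}" for \<tau>
      using that unfolding cantor.emeasure_eq_measure
      by (simp add: density_test_def flip: ennreal_mult)
  qed
  also have "\<dots> = ennreal (2 ^ k * measure cantor (eff_open W i))"
    by (simp add: cantor.emeasure_eq_measure ennreal_mult)
  finally show ?thesis by (simp add: measure_def enn2real_leI)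
qed

lemma semidecidable_less_measure_Int_preimage:
  assumes "ce_strpairs \<Phi>" "ce_natstr W" "recursive M" "recursive N" "recursive I" "recursive T"
  shows "semidecidable (\<lambda>e. M e <
    2 ^ N e * measure cantor (eff_open W (I e) \<inter> preimage \<Phi> (str (T e))))"
  unfolding eff_open_eq_open_of preimage_eq_open_of open_of_Int
  by (rule semidecidable_less_measure_open_of[OF _ assms(3,4)], unfold mem_Collect_eq Bex_def)
    (intro computability_intros semidecidable_if_decidable[OF decidable_prefix] assms(1,2)
      recursive_subst[OF assms(5)] recursive_subst[OF assms(6)])

lemma semidecidable_less_measure_incompat:
  assumes "ce_strpairs \<Phi>" "recursive M" "recursive N" "recursive T"
  shows "semidecidable (\<lambda>e. M e < 2 ^ N e * measure cantor (incompat \<Phi> (str (T e))))"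
  unfolding incompat_eq_open_of
  by (rule semidecidable_less_measure_open_of[OF _ assms(2,3)], unfold mem_Collect_eq parallel_def)
    (intro semidecidable_ex_str semidecidable_conj semidecidable_mem_strpairs
      semidecidable_if_decidable[OF decidable_not] assms(1) computability_intros
      recursive_subst[OF assms(4)])

lemma semidecidable_measure_preimage_less:
  assumes "turing_functional \<Phi>" "almost_total \<Phi>" "recursive M" "recursive N" "recursive T"
  shows "semidecidable (\<lambda>e. 2 ^ N e * measure cantor (preimage \<Phi> (str (T e))) < M e)"
proof -
  have "ce_strpairs \<Phi>" using assms(1) by (simp add: turing_functional_def)
  then have "semidecidable (\<lambda>e. 2 ^ N e < M e \<or>
      real (2 ^ N e - M e) < 2 ^ N e * measure cantor (incompat \<Phi> (str (T e))))"
    by (intro semidecidable_disj semidecidable_less_measure_incompat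
        semidecidable_if_decidable[OF decidable_less] computability_intros assms)
  moreover have "2 ^ n < m \<or> real (2 ^ n - m) < 2 ^ n * measure cantor (incompat \<Phi> \<tau>) \<longleftrightarrow>
      2 ^ n * measure cantor (preimage \<Phi> \<tau>) < m" (is "_ \<or> _ < ?I \<longleftrightarrow> ?P < _")
    for n m :: nat and \<tau>
  proof -
    have total: "?P + ?I = 2 ^ n" "0 \<le> ?I"
      by (simp_all add: measure_preimage_add_incompat[OF assms(1,2)] flip: distrib_left)
    show ?thesis
    proof (cases "2 ^ n < m")
      case True
      then have "2 ^ n < real m"
        by (metis of_nat_less_iff of_nat_numeral of_nat_power)
      with True total show ?thesis by linarith
    next
      case False
      then have "real (2 ^ n - m) = 2 ^ n - real m"
        by (simp add: of_nat_diff)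
      with False total show ?thesis by linarith
    qed
  qed
  ultimately show ?thesis by simp
qed

lemma less_iff_ex_dyadic_between:
  fixes x y :: real
  assumes "0 \<le> x"
  shows "x < y \<longleftrightarrow> (\<exists>(m :: nat) n. 2 ^ n * x < m \<and> m < 2 ^ n * y)"
proof
  assume "x < y"
  obtain n where "1 / (y - x) < 2 ^ n"
    using real_arch_pow[of 2] by auto
  then have "1 < 2 ^ n * y - 2 ^ n * x"
    using \<open>x < y\<close> by (simp add: field_simps)
  moreover have "real (nat \<lfloor>2 ^ n * x\<rfloor>) = \<lfloor>2 ^ n * x\<rfloor>"
    using assms by simp
  ultimately have "2 ^ n * x < Suc (nat \<lfloor>2 ^ n * x\<rfloor>) \<and> Suc (nat \<lfloor>2 ^ n * x\<rfloor>) < 2 ^ n * y"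
    by (simp, linarith)
  then show "\<exists>(m :: nat) n. 2 ^ n * x < m \<and> m < 2 ^ n * y" by blast
next
  assume "\<exists>(m :: nat) n. 2 ^ n * x < m \<and> m < 2 ^ n * y"
  then obtain m n :: nat where "2 ^ n * x < m" "m < 2 ^ n * y" by blast
  then have "2 ^ n * x < 2 ^ n * y" by (rule order_less_trans)
  then show "x < y" by simp
qed

lemma ce_density_test:
  assumes "turing_functional \<Phi>" "almost_total \<Phi>" "ce_natstr W"
  shows "ce_natstr (density_test \<Phi> W k)"
proof (rule ce_natstrI)
  have \<Phi>: "ce_strpairs \<Phi>" using assms(1) by (simp add: turing_functional_def)
  have "(i, \<tau>) \<in> density_test \<Phi> W k \<longleftrightarrow>
      (\<exists>(m :: nat) n. 2 ^ n * measure cantor (preimage \<Phi> \<tau>) < m \<and>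
        m < 2 ^ (n + k) * measure cantor (eff_open W i \<inter> preimage \<Phi> \<tau>))" for i \<tau>
    unfolding density_test_def mem_Collect_eq prod.case power_add mult.assoc
    by (rule less_iff_ex_dyadic_between) simp
  then show "semidecidable (\<lambda>e. (e 0, str (e (Suc 0))) \<in> density_test \<Phi> W k)"
    by (simp only:) (intro semidecidable_ex semidecidable_conj
        semidecidable_measure_preimage_less[OF assms(1,2)]
        semidecidable_less_measure_Int_preimage[OF \<Phi> assms(3)] computability_intros)
qed

lemma W2R_sparse_component:
  assumes "turing_functional \<Phi>" "almost_total \<Phi>" "induced_measure \<Phi> \<mu>" "Y \<in> W2R \<mu>"
    and W: "W2R_test cantor W"
  shows "\<exists>i. \<forall>\<tau>. prefix_of \<tau> Y \<longrightarrow>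
    2 ^ k * measure cantor (eff_open W i \<inter> preimage \<Phi> \<tau>) \<le> measure cantor (preimage \<Phi> \<tau>)"
proof -
  have "(\<lambda>i. 2 ^ k * measure cantor (eff_open W i)) \<longlonglongrightarrow> 0"
    using W tendsto_mult_right_zero unfolding W2R_test_def by blast
  then have "(\<lambda>i. measure \<mu> (eff_open (density_test \<Phi> W k) i)) \<longlonglongrightarrow> 0"
    by (rule tendsto_sandwich[OF always_eventually always_eventually tendsto_const, rotated 2])
      (auto intro: measure_density_test_le[OF assms(1,3)])
  then have "W2R_test \<mu> (density_test \<Phi> W k)"
    using ce_density_test[OF assms(1,2)] W by (simp add: W2R_test_def)
  then obtain i where "Y \<notin> eff_open (density_test \<Phi> W k) i"
    using assms(4) unfolding W2R_iff by blast
  then show ?thesis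
    by (intro exI[of _ i]) (auto simp: eff_open_def cyl_def density_test_def not_less)
qed

lemma (in finite_measure) measure_UN_Int_le_half:
  assumes [measurable]: "\<And>k. A k \<in> sets M" "E \<in> sets M"
    and sparse: "\<And>k. 2 ^ (k + 2) * measure M (A k \<inter> E) \<le> measure M E"
  shows "2 * measure M ((\<Union>k. A k) \<inter> E) \<le> measure M E"
proof -
  have le: "measure M (A k \<inter> E) \<le> (1 / 2) ^ Suc k * (measure M E / 2)" for k
    using sparse[of k] by (simp add: field_simps)
  have sums: "(\<lambda>k. (1 / 2) ^ Suc k * (measure M E / 2)) sums (measure M E / 2)"
    using sums_mult2[OF power_half_series, of "measure M E / 2"] by simp
  have summable: "summable (\<lambda>k. measure M (A k \<inter> E))"
    by (rule summable_comparison_test'[OF sums_summable[OF sums]]) (use le in auto)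
  have "measure M ((\<Union>k. A k) \<inter> E) = measure M (\<Union>k. A k \<inter> E)"
    by (simp add: Int_UN_distrib2)
  also have "\<dots> \<le> (\<Sum>k. measure M (A k \<inter> E))"
    by (rule finite_measure_subadditive_countably[OF _ summable]) auto
  also have "\<dots> \<le> measure M E / 2"
    using suminf_le[OF le summable sums_summable[OF sums]] sums_unique[OF sums] by simp
  finally show ?thesis by simp
qed

section \<open>Randomness preservation\<close>

lemma ex_sparse_open_covering_tests:
  assumes "turing_functional \<Phi>" "almost_total \<Phi>" "induced_measure \<Phi> \<mu>" "Y \<in> W2R \<mu>"
  obtains G where "open G" "\<And>W. W2R_test cantor W \<Longrightarrow> \<exists>i. eff_open W i \<subseteq> G"
    and "\<And>\<tau>. prefix_of \<tau> Y \<Longrightarrow>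
      2 * measure cantor (G \<inter> preimage \<Phi> \<tau>) \<le> measure cantor (preimage \<Phi> \<tau>)"
proof -
  define W where "W = from_nat_into {W. W2R_test cantor W}"
  have range_W: "range W = {W. W2R_test cantor W}"
    unfolding W_def using W2R_test_empty countable_W2R_tests by (intro range_from_nat_into) blast+
  then have "\<exists>i. \<forall>\<tau>. prefix_of \<tau> Y \<longrightarrow> 2 ^ (k + 2) *
      measure cantor (eff_open (W k) i \<inter> preimage \<Phi> \<tau>) \<le> measure cantor (preimage \<Phi> \<tau>)" for k
    by (intro W2R_sparse_component[OF assms]) blast
  then obtain c where c: "\<And>k \<tau>. prefix_of \<tau> Y \<Longrightarrow> 2 ^ (k + 2) *
      measure cantor (eff_open (W k) (c k) \<inter> preimage \<Phi> \<tau>) \<le> measure cantor (preimage \<Phi> \<tau>)"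
    by metis
  let ?G = "\<Union>k. eff_open (W k) (c k)"
  have "open ?G"
    unfolding eff_open_eq_open_of by (intro open_UN ballI open_open_of)
  moreover have "\<exists>i. eff_open V i \<subseteq> ?G" if "W2R_test cantor V" for V
  proof -
    obtain k where "V = W k" using \<open>W2R_test cantor V\<close> range_W by blast
    then show ?thesis by blast
  qed
  moreover have "2 * measure cantor (?G \<inter> preimage \<Phi> \<tau>) \<le> measure cantor (preimage \<Phi> \<tau>)"
    if "prefix_of \<tau> Y" for \<tau>
    by (rule cantor.measure_UN_Int_le_half[OF sets_eff_open sets_preimage c[OF that]])
  ultimately show thesis by (rule that)
qed

lemma ex_compatible_outside_open:
  assumes "turing_functional \<Phi>" "open G" and ne: "\<And>n. \<not> preimage \<Phi> (map Y [0..<n]) \<subseteq> G"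
  shows "\<exists>X. X \<notin> G \<and> (\<forall>n. X \<notin> incompat \<Phi> (map Y [0..<n]))"
proof (rule ccontr)
  let ?U = "\<lambda>n. G \<union> incompat \<Phi> (map Y [0..<n])"
  assume "\<nexists>X. X \<notin> G \<and> (\<forall>n. X \<notin> incompat \<Phi> (map Y [0..<n]))"
  then have "UNIV \<subseteq> (\<Union>n. ?U n)" by blast
  moreover have "open (?U n)" for n
    using assms(2) by (simp add: incompat_eq_open_of open_open_of open_Un)
  moreover have "incseq ?U"
  proof (rule incseq_SucI)
    have "prefix (map Y [0..<n]) (map Y [0..<Suc n])" for n by simp
    then show "?U n \<subseteq> ?U (Suc n)" for n using incompat_mono by blast
  qed
  ultimately obtain n where "UNIV \<subseteq> ?U n"
    using compact_subset_incseq_open[OF compact_UNIV_nat_bool, of ?U] by blast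
  then show False
    using ne[of n] preimage_Int_incompat[OF assms(1), of "map Y [0..<n]"] by blast
qed

theorem theorem6p18:
  fixes \<Phi> :: "(bool list \<times> bool list) set"
    and \<mu> :: "(nat \<Rightarrow> bool) measure"
    and Y :: "nat \<Rightarrow> bool"
  assumes "turing_functional \<Phi>"
    and "almost_total \<Phi>"
    and "sets \<mu> = sets cantor"
    and "\<And>\<sigma>. emeasure \<mu> (cyl \<sigma>) = emeasure cantor {X. phi_ext \<Phi> X \<sigma>}"
    and "Y \<in> W2R \<mu>"
  shows "\<exists>X. X \<in> W2R cantor \<and> X \<in> phi_dom \<Phi> \<and> phi_apply \<Phi> X = Y"
proof -
  have "induced_measure \<Phi> \<mu>" using assms(3,4) by (simp add: induced_measure_def)
  then obtain G where G: "open G" "\<And>W. W2R_test cantor W \<Longrightarrow> \<exists>i. eff_open W i \<subseteq> G"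
    and sparse: "\<And>\<tau>. prefix_of \<tau> Y \<Longrightarrow>
      2 * measure cantor (G \<inter> preimage \<Phi> \<tau>) \<le> measure cantor (preimage \<Phi> \<tau>)"
    using ex_sparse_open_covering_tests assms(1,2,5) by metis
  have "\<not> preimage \<Phi> (map Y [0..<n]) \<subseteq> G" for n
  proof
    have "0 < measure cantor (preimage \<Phi> (map Y [0..<n]))"
      using W2R_measure_cyl_pos[OF assms(5) prefix_of_map] by (simp add: measure_def assms(4))
    moreover assume "preimage \<Phi> (map Y [0..<n]) \<subseteq> G"
    ultimately show False using sparse[OF prefix_of_map, of n] by (simp add: Int_absorb1)
  qed
  with assms(1) G(1) obtain X where X: "X \<notin> G" "\<And>n. X \<notin> incompat \<Phi> (map Y [0..<n])"
    using ex_compatible_outside_open by metis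
  have "X \<in> W2R cantor" using G(2) X(1) unfolding W2R_iff by blast
  moreover from this have "X \<in> phi_dom \<Phi>" by (rule W2R_phi_dom[OF assms(1,2)])
  moreover from this have "phi_apply \<Phi> X = Y" using X(2) by (rule phi_apply_eqI)
  ultimately show ?thesis by blast
qed

end
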